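(* Let $\mu(t)$ $(t\in\mathbb R)$ be a nondecreasing $p\times p$ matrix function with $\int_{-\infty}^\infty(1+t^2)^{-1}d\mu(t)<\infty$, and let a sequence of $p\times p$ matrix functions $\mathcal P_k(t)$ $(k\in\mathbb N,\ t\in\mathbb R)$ satisfy $$\mathcal P_k(t)\ge0,\qquad \int_{-\infty}^\infty(1+t^2)^{-1}\mathcal P_k(t)\,dt\le M I_p\quad(k\in\mathbb N)$$ for some $M>0$, and $$\lim_{k\to\infty}\int_{-\infty}^x(1+t^2)^{-1}\mathcal P_k(t)\,dt=\gamma_{\mathcal P}+\int_{-\infty}^x(1+t^2)^{-1}d\mu(t)\qquad(x\in\mathbb R)$$ for some matrix $\gamma_{\mathcal P}\ge0$. Then, for all continuous and bounded functions $f(t)>0$ $(t\in\mathbb R)$, for all $a\in\mathbb R\cup\{-\infty\}$ and $b\in\mathbb R\cup\{\infty\}$ with $a<b$, we have $$\limsup_{k\to\infty}\int_a^b f(t)\ln\bigl(\det\mathcal P_k(t)\bigr)\frac{dt}{1+t^2}\ \le\ \int_a^b f(t)\ln\bigl(\det\mu'(t)\bigr)\frac{dt}{1+t^2}.$$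
   Context: The functions $(1+t^2)^{-1}\mathcal P_k(t)$ are integrable on $\mathbb R$. Matrix inequalities are in the sense of Hermitian matrices. $\int_{-\infty}^x(\cdot)\,d\mu(t)$ is a Stieltjes integral. $\mu'$ denotes the (positive semi-definite) derivative of the absolutely continuous part of $\mu$. Convention: $\ln 0=-\infty$, and the integrals of logarithms take values in $[-\infty,\infty)$. The inequality is considered to hold if its left-hand side is $-\infty$; if the right-hand side is $-\infty$, the assertion is that the left-hand side is $-\infty$ as well. *)

theory Defs
  imports "HOL-Analysis.Analysis"
begin

definition hermitian :: "complex^'p^'p \<Rightarrow> bool" where
  "hermitian A \<longleftrightarrow> (\<forall>i j. A $ i $ j = cnj (A $ j $ i))"

definition pos_semidef :: "complex^'p^'p \<Rightarrow> bool" where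
  "pos_semidef A \<longleftrightarrow>
     hermitian A \<and> (\<forall>v. 0 \<le> Re (\<Sum>i\<in>UNIV. cnj (v $ i) * (A *v v) $ i))"

definition herm_le :: "complex^'p^'p \<Rightarrow> complex^'p^'p \<Rightarrow> bool" (infix "\<le>\<^sub>H" 50) where
  "A \<le>\<^sub>H B \<longleftrightarrow> hermitian A \<and> hermitian B \<and> pos_semidef (B - A)"

abbreviation herm_nondecreasing :: "(real \<Rightarrow> complex^'p^'p) \<Rightarrow> bool" where
  "herm_nondecreasing \<mu> \<equiv> monotone (\<le>) (\<le>\<^sub>H) \<mu>"

text \<open>Riemann--Stieltjes integrals of a scalar function \<open>g\<close> against a function \<open>\<mu>\<close> with values
  in a normed space. The gauge is a ball of constant radius, so this is the mesh limit (not the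
  Henstock variant); no one-sided continuity of \<open>\<mu>\<close> is presupposed.\<close>

definition has_RS_integral ::
    "(real \<Rightarrow> real) \<Rightarrow> (real \<Rightarrow> 'a::real_normed_vector) \<Rightarrow> real \<Rightarrow> real \<Rightarrow> 'a \<Rightarrow> bool" where
  "has_RS_integral g \<mu> a b I \<longleftrightarrow>
     (\<forall>e>0. \<exists>d>0. \<forall>\<D>. \<D> tagged_division_of {a..b} \<and> (\<lambda>x. ball x d) fine \<D> \<longrightarrow>
        norm ((\<Sum>(x, K)\<in>\<D>. g x *\<^sub>R (\<mu> (Sup K) - \<mu> (Inf K))) - I) < e)"

definition has_RS_integral_atMost ::
    "(real \<Rightarrow> real) \<Rightarrow> (real \<Rightarrow> 'a::real_normed_vector) \<Rightarrow> real \<Rightarrow> 'a \<Rightarrow> bool" where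
  "has_RS_integral_atMost g \<mu> x I \<longleftrightarrow>
     (\<exists>G. (\<forall>a\<le>x. has_RS_integral g \<mu> a x (G a)) \<and> (G \<longlongrightarrow> I) at_bot)"

definition RS_integral_atMost ::
    "(real \<Rightarrow> real) \<Rightarrow> (real \<Rightarrow> 'a::real_normed_vector) \<Rightarrow> real \<Rightarrow> 'a" where
  "RS_integral_atMost g \<mu> x = (THE I. has_RS_integral_atMost g \<mu> x I)"

definition RS_integrable_UNIV ::
    "(real \<Rightarrow> real) \<Rightarrow> (real \<Rightarrow> 'a::real_normed_vector) \<Rightarrow> bool" where
  "RS_integrable_UNIV g \<mu> \<longleftrightarrow>
     (\<exists>F I. (\<forall>x. has_RS_integral_atMost g \<mu> x (F x)) \<and> (F \<longlongrightarrow> I) at_top)"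

definition absolutely_continuous_fun ::
    "(real \<Rightarrow> 'a::real_normed_vector) \<Rightarrow> real set \<Rightarrow> bool" where
  "absolutely_continuous_fun F S \<longleftrightarrow>
     (\<forall>e>0. \<exists>d>0. \<forall>\<D>. \<D> division_of \<Union>\<D> \<and> \<Union>\<D> \<subseteq> S \<and> (\<Sum>K\<in>\<D>. Sup K - Inf K) < d \<longrightarrow>
        (\<Sum>K\<in>\<D>. norm (F (Sup K) - F (Inf K))) < e)"

text \<open>Lebesgue decomposition of a nondecreasing matrix function \<open>\<mu> = \<nu> + (\<mu> - \<nu>)\<close> into a locally
  absolutely continuous part \<open>\<nu>\<close> and a singular part, i.e. a nondecreasing function whose
  derivative vanishes almost everywhere (this comprises the jumps). \<open>\<nu>\<close> is unique up to an
  additive constant, hence its derivative is unique almost everywhere.\<close>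

definition ac_part :: "(real \<Rightarrow> complex^'p^'p) \<Rightarrow> (real \<Rightarrow> complex^'p^'p) \<Rightarrow> bool" where
  "ac_part \<mu> \<nu> \<longleftrightarrow>
     herm_nondecreasing \<nu> \<and> (\<forall>a b. absolutely_continuous_fun \<nu> {a..b}) \<and>
     herm_nondecreasing (\<lambda>t. \<mu> t - \<nu> t) \<and>
     (AE t in lebesgue. ((\<lambda>t. \<mu> t - \<nu> t) has_vector_derivative 0) (at t))"

definition ac_derivative :: "(real \<Rightarrow> complex^'p^'p) \<Rightarrow> (real \<Rightarrow> complex^'p^'p) \<Rightarrow> bool" where
  "ac_derivative \<mu> \<mu>' \<longleftrightarrow>
     (\<exists>\<nu>. ac_part \<mu> \<nu> \<and> (AE t in lebesgue. (\<nu> has_vector_derivative \<mu>' t) (at t)))"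

definition ln_ext :: "real \<Rightarrow> ereal" where
  "ln_ext x = (if x > 0 then ereal (ln x) else -\<infinity>)"

text \<open>Integral of an extended-real function: the positive part minus the negative part (note that
  \<open>e2ennreal\<close> sends negative arguments to 0). The value lies in \<open>[-\<infinity>, \<infinity>)\<close> whenever the positive
  part has finite integral.\<close>

definition integral_ext :: "real set \<Rightarrow> (real \<Rightarrow> ereal) \<Rightarrow> ereal" where
  "integral_ext S g =
     enn2ereal (\<integral>\<^sup>+t\<in>S. e2ennreal (g t) \<partial>lebesgue) -
     enn2ereal (\<integral>\<^sup>+t\<in>S. e2ennreal (- g t) \<partial>lebesgue)"

text \<open>The determinant of a positive semidefinite matrix is a nonnegative real number, so taking
  its real part below loses nothing.\<close>

definition log_det_integral ::
    "ereal \<Rightarrow> ereal \<Rightarrow> (real \<Rightarrow> real) \<Rightarrow> (real \<Rightarrow> complex^'p^'p) \<Rightarrow> ereal" where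
  "log_det_integral a b f W =
     integral_ext (einterval a b) (\<lambda>t. ereal (f t / (1 + t\<^sup>2)) * ln_ext (Re (det (W t))))"

end

theory Submission
  imports Defs "HOL-Probability.Sinc_Integral"
begin

text \<open>The integrand is concave in the matrix, and a concave functional is upper semicontinuous under
  weak convergence; the singular part of \<open>\<mu>\<close> contributes nothing on the right because the logarithm
  grows sublinearly. Concretely, for \<open>A \<ge> 0\<close> and a positive definite \<open>B\<close> the tangent
  inequality \<open>ln det A \<le> tr (B\<^sup>-\<^sup>1 A) - p + ln det B\<close> holds, where \<open>p\<close> is the size of the matrices
  (\<open>log_det_tangent\<close>). It bounds the logarithm by an affine functional of \<open>P\<^sub>k\<close>, whose integral over
  an interval converges by hypothesis.

  Divide \<open>(c, d]\<close>, contained in the domain of integration, into small cells of length \<open>h\<close>. On a cell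
  \<open>I = (x, x + h]\<close> use the tangent at \<open>B\<^sub>I = D\<^sub>I + \<delta>\<close>, where \<open>D\<^sub>I = (\<mu>(x + h) - \<mu>(x)) / h\<close> is the slope
  of \<open>\<mu>\<close>. As \<open>k\<close> tends to infinity, \<open>P\<^sub>k dt / (1 + t\<^sup>2)\<close> is replaced by \<open>d\<mu> / (1 + t\<^sup>2)\<close>, and since
  \<open>tr (B\<^sub>I\<^sup>-\<^sup>1 D\<^sub>I) \<le> p\<close> the trace term is compensated by \<open>- p\<close>, up to the oscillation of \<open>f\<close> and of
  the weight on the cells. What remains is the integral of the step function \<open>ln det B\<^sub>I\<close>. Outside
  \<open>(c, d]\<close> the tangent at a large multiple \<open>1/\<epsilon>\<close> of the identity costs at most a multiple of
  \<open>\<epsilon>\<close> plus a multiple of the measure of the remaining set. This is \<open>step_estimate\<close>. Since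
  \<open>f\<close> is bounded by a constant on each cell, convergence of the masses of the cells suffices.

  Now let \<open>(c, d]\<close> exhaust the domain, and let the mesh and \<open>\<delta>\<close> tend to zero. The slopes converge to
  the derivative of \<open>\<mu>\<close>, which is \<open>\<mu>'\<close> almost everywhere since the singular part has derivative zero
  there, so the step functions converge almost everywhere to \<open>ln det \<mu>'\<close>. A reversed Fatou lemma
  (\<open>limsup_set_integral_le_integral_ext\<close>) passes to the limit, provided that the step functions have an
  integrable upper bound. They are therefore truncated at the constant \<open>R = - p (1 + ln \<epsilon>)\<close>: by the
  tangent inequality at \<open>1/\<epsilon>\<close> the truncation removes at most \<open>\<epsilon> tr B\<^sub>I\<close>, whose integral is of order \<open>\<epsilon>\<close>
  uniformly. Finally \<open>\<epsilon>\<close> tends to zero.\<close>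

section \<open>The determinant of positive semidefinite matrices\<close>

definition cadj :: "complex^'p^'p \<Rightarrow> complex^'p^'p" where
  "cadj A = (\<chi> i j. cnj (A $ j $ i))"

lemma matrix_mult_add_left: "(A + B) ** C = A ** C + B ** (C :: complex^'p^'p)"
  by (simp add: matrix_matrix_mult_def vec_eq_iff sum.distrib algebra_simps)

lemma matrix_mult_scaleR:
  fixes A B :: "complex^'p^'p"
  shows "(r *\<^sub>R A) ** B = r *\<^sub>R (A ** B)" "A ** (r *\<^sub>R B) = r *\<^sub>R (A ** B)"
  by (simp_all add: matrix_matrix_mult_def vec_eq_iff scaleR_sum_right)

lemma cadj_mult: "cadj (A ** B) = cadj B ** cadj A"
  by (simp add: cadj_def matrix_matrix_mult_def vec_eq_iff mult.commute)

lemma cadj_cadj: "cadj (cadj A) = A"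
  by (simp add: cadj_def vec_eq_iff)

lemma hermitian_iff_cadj: "hermitian A \<longleftrightarrow> cadj A = A"
  by (simp add: hermitian_def cadj_def vec_eq_iff) metis

lemma det_cadj: "det (cadj A) = cnj (det A)"
proof -
  have "cadj A = transpose (\<chi> i j. cnj (A $ i $ j))"
    by (simp add: cadj_def transpose_def)
  then have "det (cadj A) = det (\<chi> i j. cnj (A $ i $ j))"
    by simp
  also have "\<dots> = cnj (det A)"
    by (simp add: det_def)
  finally show ?thesis .
qed

lemma form_cadj:
  "(\<Sum>i\<in>UNIV. cnj (v $ i) * (C *v z) $ i) = (\<Sum>i\<in>UNIV. cnj ((cadj C *v v) $ i) * z $ i)"
  (is "?l = ?r")
proof -
  have "?l = (\<Sum>i\<in>UNIV. \<Sum>j\<in>UNIV. cnj (v $ i) * C $ i $ j * z $ j)"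
    by (simp add: matrix_vector_mult_def sum_distrib_left mult.assoc)
  also have "\<dots> = (\<Sum>j\<in>UNIV. \<Sum>i\<in>UNIV. cnj (v $ i) * C $ i $ j * z $ j)"
    by (rule sum.swap)
  also have "\<dots> = ?r"
    by (simp add: matrix_vector_mult_def cadj_def sum_distrib_right sum_distrib_left mult_ac)
  finally show ?thesis .
qed

lemma pos_semidef_congruence:
  assumes "pos_semidef A"
  shows "pos_semidef (C ** A ** cadj C)"
  unfolding pos_semidef_def
proof
  show "hermitian (C ** A ** cadj C)"
    using assms by (simp add: pos_semidef_def hermitian_iff_cadj cadj_mult cadj_cadj matrix_mul_assoc)
  show "\<forall>v. 0 \<le> Re (\<Sum>i\<in>UNIV. cnj (v $ i) * ((C ** A ** cadj C) *v v) $ i)"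
  proof
    fix v
    have eq: "(C ** A ** cadj C) *v v = C *v (A *v (cadj C *v v))"
      by (simp add: matrix_vector_mul_assoc matrix_mul_assoc)
    have "0 \<le> Re (\<Sum>i\<in>UNIV. cnj ((cadj C *v v) $ i) * (A *v (cadj C *v v)) $ i)"
      using assms unfolding pos_semidef_def by blast
    then show "0 \<le> Re (\<Sum>i\<in>UNIV. cnj (v $ i) * ((C ** A ** cadj C) *v v) $ i)"
      unfolding eq form_cadj[of v C] .
  qed
qed

lemma pos_semidef_hermitianD: "pos_semidef A \<Longrightarrow> A $ i $ j = cnj (A $ j $ i)"
  unfolding pos_semidef_def hermitian_def by blast

text \<open>The quadratic form evaluated at a vector supported on two coordinates.\<close>

lemma pos_semidef_pairD:
  fixes A :: "complex^'p^'p"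
  assumes "pos_semidef A" "i \<noteq> j"
  shows "0 \<le> Re (cnj x * x * A $ i $ i + cnj x * y * A $ i $ j + cnj y * x * A $ j $ i + cnj y * y * A $ j $ j)"
proof -
  define v :: "complex^'p" where "v = (\<chi> k. if k = i then x else if k = j then y else 0)"
  have *: "(\<Sum>k\<in>UNIV. g k (v $ k)) = g i x + g j y"
    if "\<And>k. g k 0 = (0::complex)" for g :: "'p \<Rightarrow> complex \<Rightarrow> complex"
  proof -
    have "(\<Sum>k\<in>UNIV. g k (v $ k)) = (\<Sum>k\<in>{i,j}. g k (v $ k))"
      by (rule sum.mono_neutral_right) (auto simp: v_def that)
    then show ?thesis
      using assms by (simp add: v_def)
  qed
  have "0 \<le> Re (\<Sum>k\<in>UNIV. cnj (v $ k) * (A *v v) $ k)"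
    using assms by (simp add: pos_semidef_def)
  also have "(\<Sum>k\<in>UNIV. cnj (v $ k) * (A *v v) $ k) = 
      cnj x * (A *v v) $ i + cnj y * (A *v v) $ j"
    by (rule *[of "\<lambda>k z. cnj z * (A *v v) $ k"]) simp
  also have "(A *v v) $ i = A $ i $ i * x + A $ i $ j * y"
    using *[of "\<lambda>k z. A $ i $ k * z"] by (simp add: matrix_vector_mult_def)
  also have "(A *v v) $ j = A $ j $ i * x + A $ j $ j * y"
    using *[of "\<lambda>k z. A $ j $ k * z"] by (simp add: matrix_vector_mult_def)
  finally show ?thesis
    by (simp add: algebra_simps)
qed

lemma pos_semidef_diag_nonneg:
  fixes A :: "complex^'p^'p"
  assumes "pos_semidef A"
  shows "0 \<le> Re (A $ i $ i)"
proof -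
  have "0 \<le> Re (\<Sum>k\<in>UNIV. cnj (axis i 1 $ k) * (A *v axis i 1) $ k)"
    using assms by (simp add: pos_semidef_def)
  also have "(\<Sum>k\<in>UNIV. cnj (axis i 1 $ k) * (A *v axis i 1) $ k) = A $ i $ i"
    by (simp add: matrix_vector_mult_def axis_def if_distrib if_distribR cong: if_cong)
  finally show ?thesis .
qed

lemma pos_semidef_diag_real:
  assumes "pos_semidef A"
  shows "A $ i $ i = of_real (Re (A $ i $ i))"
proof -
  have "A $ i $ i \<in> \<real>"
    using pos_semidef_hermitianD[OF assms, of i i] by (metis Reals_cnj_iff)
  then show ?thesis
    by (rule of_real_Re[symmetric])
qed

lemma pos_semidef_zero_diag:
  fixes A :: "complex^'p^'p"
  assumes psd: "pos_semidef A" and z: "A $ s $ s = 0"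
  shows "A $ s $ j = 0"
proof (cases "j = s")
  case True
  then show ?thesis
    by (simp only: z)
next
  case False
  obtain x y where xy: "A $ s $ j = Complex x y"
    by (cases "A $ s $ j")
  have js: "A $ j $ s = Complex x (- y)"
    using pos_semidef_hermitianD[OF psd, of j s] unfolding xy by (simp only: complex_cnj)
  define r where "r = Re (A $ j $ j)"
  have r: "r \<ge> 0"
    unfolding r_def by (rule pos_semidef_diag_nonneg[OF psd])
  define m where "m = x * x + y * y"
  \<comment> \<open>The quadratic form at the vector with entries \<open>- l A\<^sub>s\<^sub>j\<close> and \<open>1\<close> is affine in \<open>l\<close>, because the
    quadratic term carries the vanishing diagonal entry.\<close>
  have *: "0 \<le> r - 2 * l * m" for l
  proof -
    have "0 \<le> Re (cnj (Complex (- l * x) (- l * y)) * Complex x y + Complex (- l * x) (- l * y) * Complex x (- y) + A $ j $ j)"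
      using pos_semidef_pairD[OF psd False[symmetric], of "Complex (- l * x) (- l * y)" 1]
      unfolding z xy js by simp
    then show ?thesis
      unfolding r_def m_def by (simp add: algebra_simps)
  qed
  have "m = 0"
  proof (rule ccontr)
    assume "m \<noteq> 0"
    then have "r - 2 * ((r + 1) / (2 * m)) * m = - 1"
      by (simp add: field_simps)
    then show False
      using *[of "(r + 1) / (2 * m)"] by linarith
  qed
  then have "x = 0 \<and> y = 0"
    unfolding m_def by (rule sum_squares_eq_zero_iff[THEN iffD1])
  then show ?thesis
    unfolding xy Complex_eq_0 .
qed

lemma det_column_shear:
  fixes c :: "'p::finite \<Rightarrow> complex"
  assumes "c s = 0"
  shows "det (mat 1 + (\<chi> i j. if j = s then c i else 0)) = (1::complex)"
proof -
  let ?I = "mat 1 :: complex^'p^'p"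
  define x where "x = (\<chi> i. c i)"
  have x: "x = (\<Sum>i\<in>UNIV - {s}. c i *s row i ?I)"
  proof (rule vec_eq_iff[THEN iffD2, rule_format])
    fix j
    have "(\<Sum>i\<in>UNIV - {s}. c i *s row i ?I) $ j = (\<Sum>i\<in>UNIV. if i = j then c i else 0)"
      unfolding sum_component
      by (rule sum.mono_neutral_cong_left) (use assms in \<open>auto simp: row_def mat_def\<close>)
    then show "x $ j = (\<Sum>i\<in>UNIV - {s}. c i *s row i ?I) $ j"
      by (simp add: x_def)
  qed
  have "x \<in> vec.span {row j ?I |j. j \<noteq> s}"
    unfolding x by (intro vec.span_sum vec.span_scale vec.span_base) auto
  then have "det (\<chi> k. if k = s then row s ?I + x else row k ?I) = det ?I"
    by (rule det_row_span)
  moreover have "(\<chi> k. if k = s then row s ?I + x else row k ?I) = 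
      transpose (mat 1 + (\<chi> i j. if j = s then c i else 0))"
    by (auto simp: vec_eq_iff row_def mat_def x_def transpose_def)
  ultimately show ?thesis
    by simp
qed

text \<open>Gaussian elimination by congruences of determinant one. A vanishing pivot needs no elimination,
  because its row vanishes too; otherwise the elimination subtracts \<open>|B\<^sub>i\<^sub>s|\<^sup>2 / B\<^sub>s\<^sub>s\<close> from the diagonal
  entries, so that they decrease. This monotonicity yields Hadamard's inequality.\<close>

lemma pos_semidef_diagonalize:
  fixes A :: "complex^'p^'p"
  assumes psd: "pos_semidef A"
  shows "\<exists>L. det L = 1 \<and> (\<forall>i j. i \<noteq> j \<longrightarrow> (L ** A ** cadj L) $ i $ j = 0) \<and>
             (\<forall>i. Re ((L ** A ** cadj L) $ i $ i) \<le> Re (A $ i $ i))"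
proof -
  have "\<exists>L. det L = 1 \<and> (\<forall>i\<in>T. \<forall>j. i \<noteq> j \<longrightarrow> (L ** A ** cadj L) $ i $ j = 0) \<and>
             (\<forall>i. Re ((L ** A ** cadj L) $ i $ i) \<le> Re (A $ i $ i))" if "finite T" for T :: "'p set"
    using that
  proof induction
    case empty
    have "cadj (mat 1) = (mat 1 :: complex^'p^'p)"
      by (auto simp: cadj_def mat_def vec_eq_iff)
    then show ?case
      by (intro exI[of _ "mat 1"]) simp
  next
    case (insert s T)
    then obtain L where L: "det L = 1" "\<And>i j. i \<in> T \<Longrightarrow> i \<noteq> j \<Longrightarrow> (L ** A ** cadj L) $ i $ j = 0"
      "\<And>i. Re ((L ** A ** cadj L) $ i $ i) \<le> Re (A $ i $ i)"
      by blast
    define B where "B = L ** A ** cadj L"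
    have B: "pos_semidef B"
      unfolding B_def by (rule pos_semidef_congruence[OF psd])
    have BH: "cnj (B $ i $ j) = B $ j $ i" for i j
      by (rule pos_semidef_hermitianD[OF B, symmetric])
    show ?case
    proof (cases "B $ s $ s = 0")
      case True
      then show ?thesis
        using L pos_semidef_zero_diag[OF B True] by (intro exI[of _ L]) (auto simp: B_def)
    next
      case False
      define c where "c i = (if i = s then 0 else - B $ i $ s / B $ s $ s)" for i
      define E where "E = mat 1 + (\<chi> i j. if j = s then c i else 0)"
      have detE: "det E = 1"
        unfolding E_def by (rule det_column_shear) (simp add: c_def)
      have EB: "(E ** X) $ i $ j = X $ i $ j + c i * X $ s $ j" for X :: "complex^'p^'p" and i j
      proof -
        have "E ** X = X + (\<chi> i j. if j = s then c i else 0) ** X"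
          unfolding E_def matrix_mult_add_left by simp
        then show ?thesis
          by (simp add: matrix_matrix_mult_def if_distrib if_distribR cong: if_cong)
      qed
      have BE: "(X ** cadj E) $ i $ j = X $ i $ j + X $ i $ s * cnj (c j)" for X :: "complex^'p^'p" and i j
      proof -
        have "X ** cadj E = cadj (E ** cadj X)"
          by (simp add: cadj_mult cadj_cadj)
        then show ?thesis
          by (simp add: cadj_def EB mult.commute)
      qed
      have new: "(E ** B ** cadj E) $ i $ j = 
          (if i = s \<or> j = s then if i = j then B $ s $ s else 0 
           else B $ i $ j - B $ i $ s * B $ s $ j / B $ s $ s)" for i j
        using False by (auto simp: EB BE c_def BH field_simps) 
      have EL: "(E ** L) ** A ** cadj (E ** L) = E ** B ** cadj E"
        by (simp add: B_def cadj_mult matrix_mul_assoc)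
      have "Re ((E ** B ** cadj E) $ i $ i) \<le> Re (B $ i $ i)" for i
      proof (cases "i = s")
        case False
        have "B $ i $ s * B $ s $ i = of_real ((cmod (B $ i $ s))\<^sup>2)"
          by (simp only: complex_norm_square BH)
        then have "B $ i $ s * B $ s $ i / B $ s $ s = of_real ((cmod (B $ i $ s))\<^sup>2 / Re (B $ s $ s))"
          by (subst pos_semidef_diag_real[OF B]) simp
        then show ?thesis
          using False pos_semidef_diag_nonneg[OF B, of s] by (simp add: new)
      qed (simp add: new)
      then have "Re ((E ** B ** cadj E) $ i $ i) \<le> Re (A $ i $ i)" for i
        using L(3)[of i] order_trans unfolding B_def by blast
      moreover have "(E ** B ** cadj E) $ i $ j = 0" if "i \<in> insert s T" "i \<noteq> j" for i j
        using that L(2)[of i j] L(2)[of i s] by (auto simp: new B_def[symmetric])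
      ultimately show ?thesis
        using L(1) detE by (intro exI[of _ "E ** L"]) (simp add: EL det_mul)
    qed
  qed
  from this[of UNIV] show ?thesis
    by simp
qed

lemma diagonal_congruence_det:
  fixes A :: "complex^'p^'p"
  assumes psd: "pos_semidef A" and L: "det L = 1" 
    and diag: "\<And>i j. i \<noteq> j \<Longrightarrow> (L ** A ** cadj L) $ i $ j = 0"
  shows "det A = of_real (\<Prod>i\<in>UNIV. Re ((L ** A ** cadj L) $ i $ i))"
proof -
  have "det A = det (L ** A ** cadj L)"
    by (simp add: det_mul det_cadj L)
  also have "\<dots> = (\<Prod>i\<in>UNIV. (L ** A ** cadj L) $ i $ i)"
    by (rule det_diagonal) (rule diag)
  also have "\<dots> = of_real (\<Prod>i\<in>UNIV. Re ((L ** A ** cadj L) $ i $ i))"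
    unfolding of_real_prod
    by (intro prod.cong refl pos_semidef_diag_real pos_semidef_congruence psd)
  finally show ?thesis .
qed

lemma hadamard_inequality:
  fixes A :: "complex^'p^'p"
  assumes psd: "pos_semidef A"
  shows "Re (det A) \<le> (\<Prod>i\<in>UNIV. Re (A $ i $ i))"
proof -
  obtain L where L: "det L = 1" "\<And>i j. i \<noteq> j \<Longrightarrow> (L ** A ** cadj L) $ i $ j = 0"
      "\<And>i. Re ((L ** A ** cadj L) $ i $ i) \<le> Re (A $ i $ i)"
    using pos_semidef_diagonalize[OF psd] by blast
  have "Re (det A) = (\<Prod>i\<in>UNIV. Re ((L ** A ** cadj L) $ i $ i))"
    using diagonal_congruence_det[OF psd L(1,2)] by (simp del: of_real_prod)
  also have "\<dots> \<le> (\<Prod>i\<in>UNIV. Re (A $ i $ i))"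
    by (intro prod_mono) (auto simp: L pos_semidef_diag_nonneg pos_semidef_congruence psd)
  finally show ?thesis .
qed

text \<open>The inequality of the arithmetic and geometric means in the form \<open>a \<le> g exp (a/g - 1)\<close>, which
  costs nothing at \<open>a = g\<close>; this makes the bound a tangent.\<close>

lemma det_le_exp:
  fixes A :: "complex^'p^'p" and g :: "'p \<Rightarrow> real"
  assumes psd: "pos_semidef A" and g: "\<And>i. g i > 0"
  shows "Re (det A) \<le> (\<Prod>i\<in>UNIV. g i) * exp ((\<Sum>i\<in>UNIV. Re (A $ i $ i) / g i) - real CARD('p))"
proof -
  have "Re (det A) \<le> (\<Prod>i\<in>UNIV. Re (A $ i $ i))"
    by (rule hadamard_inequality[OF psd])
  also have "\<dots> \<le> (\<Prod>i\<in>UNIV. g i * exp (Re (A $ i $ i) / g i - 1))"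
  proof (intro prod_mono conjI pos_semidef_diag_nonneg[OF psd])
    fix i
    have "Re (A $ i $ i) / g i \<le> exp (Re (A $ i $ i) / g i - 1)"
      using exp_ge_add_one_self[of "Re (A $ i $ i) / g i - 1"] by simp
    then show "Re (A $ i $ i) \<le> g i * exp (Re (A $ i $ i) / g i - 1)"
      using g[of i] by (simp add: pos_divide_le_eq mult.commute)
  qed
  also have "\<dots> = (\<Prod>i\<in>UNIV. g i) * exp ((\<Sum>i\<in>UNIV. Re (A $ i $ i) / g i) - real CARD('p))"
    by (simp add: prod.distrib exp_sum[symmetric] sum_subtractf)
  finally show ?thesis .
qed

lemma ln_ext_leI:
  assumes "x \<le> y * exp z" "y > 0"
  shows "ln_ext x \<le> ereal (z + ln y)"
proof (cases "x > 0")
  case True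
  then have "ln x \<le> ln (y * exp z)"
    using assms by simp
  also have "\<dots> = z + ln y"
    using assms by (simp add: ln_mult)
  finally show ?thesis
    using True by (simp add: ln_ext_def)
qed (simp add: ln_ext_def)

lemma log_det_le_trace:
  fixes A :: "complex^'p^'p"
  assumes psd: "pos_semidef A" and \<epsilon>: "\<epsilon> > 0"
  shows "ln_ext (Re (det A)) \<le> ereal (\<epsilon> * Re (trace A) - real CARD('p) * (1 + ln \<epsilon>))"
proof -
  have "Re (det A) \<le> (1 / \<epsilon>) ^ CARD('p) * exp (\<epsilon> * Re (trace A) - real CARD('p))"
    using det_le_exp[OF psd, of "\<lambda>_. 1 / \<epsilon>"] \<epsilon> 
    by (simp add: trace_def sum_distrib_left mult.commute)
  from ln_ext_leI[OF this] show ?thesis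
    using \<epsilon> by (simp add: ln_realpow ln_div algebra_simps)
qed

lemma pos_semidef_add:
  assumes "pos_semidef A" "pos_semidef B"
  shows "pos_semidef (A + B)"
  unfolding pos_semidef_def
proof
  show "hermitian (A + B)"
    unfolding hermitian_def vector_add_component complex_cnj_add
    using pos_semidef_hermitianD[OF assms(1)] pos_semidef_hermitianD[OF assms(2)] by metis
  show "\<forall>v. 0 \<le> Re (\<Sum>i\<in>UNIV. cnj (v $ i) * ((A + B) *v v) $ i)"
    using assms unfolding pos_semidef_def
    by (simp add: matrix_vector_mult_add_rdistrib distrib_left sum.distrib del: Re_sum)
qed

lemma cong_scaleR_mat1:
  fixes L :: "complex^'p^'p"
  shows "(L ** (\<delta> *\<^sub>R mat 1) ** cadj L) $ i $ i = of_real (\<delta> * (\<Sum>j\<in>UNIV. (cmod (L $ i $ j))\<^sup>2))"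
proof -
  have "L ** (\<delta> *\<^sub>R mat 1) ** cadj L = \<delta> *\<^sub>R (L ** cadj L)"
    by (simp only: matrix_mult_scaleR matrix_mul_rid)
  then have "(L ** (\<delta> *\<^sub>R mat 1) ** cadj L) $ i $ i = \<delta> *\<^sub>R (\<Sum>j\<in>UNIV. L $ i $ j * cnj (L $ i $ j))"
    by (simp only: vector_scaleR_component) (simp add: matrix_matrix_mult_def cadj_def)
  then show ?thesis
    by (simp only: complex_norm_square[symmetric] scaleR_conv_of_real of_real_mult of_real_sum)
qed

lemma pos_semidef_scaleR_mat1:
  assumes "\<delta> \<ge> 0"
  shows "pos_semidef (\<delta> *\<^sub>R mat 1 :: complex^'p^'p)"
  unfolding pos_semidef_def
proof
  show "hermitian (\<delta> *\<^sub>R mat 1 :: complex^'p^'p)"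
    by (simp add: hermitian_def mat_def)
  have "(\<delta> *\<^sub>R mat 1) *v v = \<delta> *\<^sub>R v" for v :: "complex^'p"
    by (simp add: matrix_vector_mult_def vec_eq_iff mat_def if_distrib if_distribR cong: if_cong)
  then show "\<forall>v :: complex^'p. 0 \<le> Re (\<Sum>i\<in>UNIV. cnj (v $ i) * ((\<delta> *\<^sub>R mat 1) *v v) $ i)"
    using assms by (auto intro!: sum_nonneg)
qed

text \<open>Concavity of the logarithm of the determinant at \<open>B = D + \<delta>\<close>. The functional \<open>\<psi>\<close> is
  \<open>A \<mapsto> tr (B\<^sup>-\<^sup>1 A)\<close>: if \<open>L\<close> has determinant one and \<open>L B L\<^sup>*\<close> is diagonal with entries \<open>g\<^sub>i\<close>, it is
  the sum of the diagonal entries of \<open>L A L\<^sup>*\<close> divided by \<open>g\<^sub>i\<close>. Written this way it needs neither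
  an inverse nor a square root, and the tangent inequality is Hadamard's inequality for \<open>L A L\<^sup>*\<close>.
  The bound \<open>\<psi> D \<le> p\<close> follows from \<open>D \<le> B\<close> and \<open>\<psi> B = p\<close>.\<close>

lemma log_det_tangent:
  fixes D :: "complex^'p^'p"
  assumes psd: "pos_semidef D" and \<delta>: "\<delta> > 0"
  shows "Re (det (D + \<delta> *\<^sub>R mat 1)) > 0"
    and "\<exists>\<psi> :: complex^'p^'p \<Rightarrow> real. bounded_linear \<psi> \<and> (\<forall>A. pos_semidef A \<longrightarrow> 0 \<le> \<psi> A) \<and> 
      \<psi> D \<le> real CARD('p) \<and> 
      (\<forall>A. pos_semidef A \<longrightarrow> 
        ln_ext (Re (det A)) \<le> ereal (\<psi> A - real CARD('p) + ln (Re (det (D + \<delta> *\<^sub>R mat 1)))))"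
proof -
  define B where "B = D + \<delta> *\<^sub>R mat 1"
  have B: "pos_semidef B"
    unfolding B_def using psd \<delta> by (intro pos_semidef_add pos_semidef_scaleR_mat1) auto
  obtain L where L: "det L = 1" "\<And>i j. i \<noteq> j \<Longrightarrow> (L ** B ** cadj L) $ i $ j = 0"
    using pos_semidef_diagonalize[OF B] by blast
  define g where "g i = Re ((L ** B ** cadj L) $ i $ i)" for i
  define \<psi> where "\<psi> A = (\<Sum>i\<in>UNIV. Re ((L ** A ** cadj L) $ i $ i) / g i)" for A
  have row: "(\<Sum>j\<in>UNIV. (cmod (L $ i $ j))\<^sup>2) > 0" for i
  proof -
    have "row i L \<noteq> 0"
      using det_zero_row(1)[of i L] L(1) by auto
    then obtain j where "L $ i $ j \<noteq> 0"
      by (auto simp: row_def vec_eq_iff)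
    then show ?thesis
      by (intro sum_pos2[of _ j]) auto
  qed
  have split: "L ** B ** cadj L = L ** D ** cadj L + L ** (\<delta> *\<^sub>R mat 1) ** cadj L"
    by (simp add: B_def matrix_add_ldistrib matrix_mult_add_left)
  have gD: "g i = Re ((L ** D ** cadj L) $ i $ i) + \<delta> * (\<Sum>j\<in>UNIV. (cmod (L $ i $ j))\<^sup>2)" for i
    unfolding g_def split by (simp only: vector_add_component cong_scaleR_mat1 plus_complex.sel Re_complex_of_real)
  have less: "Re ((L ** D ** cadj L) $ i $ i) < g i" for i
    using mult_pos_pos[OF \<delta> row[of i]] by (simp add: gD)
  have g: "g i > 0" for i
    using less[of i] pos_semidef_diag_nonneg[OF pos_semidef_congruence[OF psd, of L], of i] by linarith
  have detB: "Re (det B) = (\<Prod>i\<in>UNIV. g i)"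
    using diagonal_congruence_det[OF B L] by (simp add: g_def del: of_real_prod)
  then show pos: "Re (det (D + \<delta> *\<^sub>R mat 1)) > 0"
    using g by (simp add: B_def[symmetric] prod_pos)
  have "linear \<psi>"
  proof (rule linearI)
    show "\<psi> (X + Y) = \<psi> X + \<psi> Y" for X Y
      by (simp add: \<psi>_def matrix_add_ldistrib matrix_mult_add_left add_divide_distrib sum.distrib)
    show "\<psi> (r *\<^sub>R X) = r *\<^sub>R \<psi> X" for r X
      by (simp add: \<psi>_def matrix_mult_scaleR sum_distrib_left)
  qed
  moreover have "0 \<le> \<psi> A" if "pos_semidef A" for A
    unfolding \<psi>_def using that less_imp_le[OF g]
    by (intro sum_nonneg divide_nonneg_nonneg) (auto intro: pos_semidef_diag_nonneg pos_semidef_congruence)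
  moreover have "\<psi> D \<le> real CARD('p)"
  proof -
    have "\<psi> D \<le> (\<Sum>i\<in>(UNIV::'p set). 1)"
      unfolding \<psi>_def using less_imp_le[OF less] g by (intro sum_mono) simp
    then show ?thesis by simp
  qed
  moreover have "ln_ext (Re (det A)) \<le> ereal (\<psi> A - real CARD('p) + ln (Re (det B)))" if A: "pos_semidef A" for A
  proof -
    have "Re (det A) = Re (det (L ** A ** cadj L))"
      by (simp add: det_mul det_cadj L)
    also have "\<dots> \<le> Re (det B) * exp (\<psi> A - real CARD('p))"
      using det_le_exp[OF pos_semidef_congruence[OF A, of L], of g] g by (simp add: detB \<psi>_def)
    finally show ?thesis
      using pos by (intro ln_ext_leI) (auto simp: B_def)
  qed
  ultimately show "\<exists>\<psi> :: complex^'p^'p \<Rightarrow> real. bounded_linear \<psi> \<and> (\<forall>A. pos_semidef A \<longrightarrow> 0 \<le> \<psi> A) \<and> 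
      \<psi> D \<le> real CARD('p) \<and> 
      (\<forall>A. pos_semidef A \<longrightarrow> 
        ln_ext (Re (det A)) \<le> ereal (\<psi> A - real CARD('p) + ln (Re (det (D + \<delta> *\<^sub>R mat 1)))))"
    unfolding B_def linear_conv_bounded_linear by blast
qed

lemma bounded_linear_scale:
  fixes \<psi> :: "'a::real_normed_vector \<Rightarrow> real"
  shows "bounded_linear \<psi> \<Longrightarrow> \<psi> (r *\<^sub>R A) = r * \<psi> A"
  by (simp add: linear_scale[OF bounded_linear.linear])

lemma bounded_linear_Re_trace: "bounded_linear (\<lambda>A :: complex^'p^'p. Re (trace A))"
  unfolding trace_def Re_sum
  by (intro bounded_linear_sum bounded_linear_compose[OF bounded_linear_Re]
      bounded_linear_compose[OF bounded_linear_vec_nth bounded_linear_vec_nth])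

lemma Re_trace_scaleR_mat1: "Re (trace (r *\<^sub>R mat 1 :: complex^'p^'p)) = r * real CARD('p)"
  by (simp add: bounded_linear_scale[OF bounded_linear_Re_trace] trace_I)

lemma pos_semidef_trace_nonneg: "pos_semidef A \<Longrightarrow> 0 \<le> Re (trace A)"
  by (simp add: trace_def sum_nonneg pos_semidef_diag_nonneg)

lemma pos_semidef_scaleR:
  assumes "pos_semidef A" "r \<ge> 0"
  shows "pos_semidef (r *\<^sub>R A)"
  unfolding pos_semidef_def
proof
  show "hermitian (r *\<^sub>R A)"
    unfolding hermitian_def vector_scaleR_component
    using pos_semidef_hermitianD[OF assms(1)] by (metis complex_cnj_scaleR)
  have "cnj (v $ i) * ((r *\<^sub>R A) *v v) $ i = r *\<^sub>R (cnj (v $ i) * (A *v v) $ i)" for v i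
    by (simp add: matrix_vector_mult_def scaleR_sum_right[symmetric])
  then have "(\<Sum>i\<in>UNIV. cnj (v $ i) * ((r *\<^sub>R A) *v v) $ i) = r *\<^sub>R (\<Sum>i\<in>UNIV. cnj (v $ i) * (A *v v) $ i)" for v
    by (simp add: scaleR_sum_right)
  then show "\<forall>v. 0 \<le> Re (\<Sum>i\<in>UNIV. cnj (v $ i) * ((r *\<^sub>R A) *v v) $ i)"
    using assms by (simp add: pos_semidef_def del: Re_sum)
qed

lemma tendsto_Re_det:
  fixes A :: "'b \<Rightarrow> complex^'p^'p"
  assumes "(A \<longlongrightarrow> L) F"
  shows "((\<lambda>x. Re (det (A x))) \<longlongrightarrow> Re (det L)) F"
  unfolding det_def by (intro tendsto_intros assms)

section \<open>Stieltjes integrals and difference quotients\<close>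

lemma has_RS_integral_eventually:
  assumes "has_RS_integral g \<mu> a b I" "e > 0"
  shows "\<forall>\<^sub>F d in at_right 0. \<forall>\<D>. \<D> tagged_division_of {a..b} \<and> (\<lambda>x. ball x d) fine \<D> \<longrightarrow>
        norm ((\<Sum>(x, K)\<in>\<D>. g x *\<^sub>R (\<mu> (Sup K) - \<mu> (Inf K))) - I) < e"
proof -
  let ?close = "\<lambda>\<D>. norm ((\<Sum>(x, K)\<in>\<D>. g x *\<^sub>R (\<mu> (Sup K) - \<mu> (Inf K))) - I) < e"
  from assms obtain d0 where "d0 > 0" 
    and d0: "\<forall>\<D>. \<D> tagged_division_of {a..b} \<and> (\<lambda>x. ball x d0) fine \<D> \<longrightarrow> ?close \<D>"
    unfolding has_RS_integral_def by (elim allE[of _ e] impE exE conjE)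
  show ?thesis
    unfolding eventually_at_right_field
  proof (intro exI[of _ d0] conjI \<open>d0 > 0\<close> allI impI)
    fix d \<D> assume d: "0 < d" "d < d0" and D: "\<D> tagged_division_of {a..b} \<and> (\<lambda>x. ball x d) fine \<D>"
    have "(\<lambda>x. ball x d0) fine \<D>"
      using D d(2) unfolding fine_def by fastforce
    then show "?close \<D>"
      using D d0 by blast
  qed
qed

lemma fine_ball_division:
  fixes a b :: real
  assumes "d > 0"
  obtains \<D> where "\<D> tagged_division_of {a..b}" "(\<lambda>x. ball x d) fine \<D>"
  using fine_division_exists_real[of "\<lambda>x. ball x d" a b] assms by (auto simp: gauge_def)

lemma has_RS_integral_approx:
  assumes "has_RS_integral g \<mu> a b I" "e > 0"
  obtains \<D> where "\<D> tagged_division_of {a..b}"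
    "norm ((\<Sum>(x, K)\<in>\<D>. g x *\<^sub>R (\<mu> (Sup K) - \<mu> (Inf K))) - I) < e"
proof -
  from eventually_happens[OF eventually_conj[OF eventually_at_right_less 
      has_RS_integral_eventually[OF assms]]]
  obtain d where "d > 0" and d: "\<forall>\<D>. \<D> tagged_division_of {a..b} \<and> (\<lambda>x. ball x d) fine \<D> \<longrightarrow> 
      norm ((\<Sum>(x, K)\<in>\<D>. g x *\<^sub>R (\<mu> (Sup K) - \<mu> (Inf K))) - I) < e"
    by (auto simp: trivial_limit_at_right_real)
  obtain \<D> where "\<D> tagged_division_of {a..b}" "(\<lambda>x. ball x d) fine \<D>"
    using fine_ball_division[OF \<open>d > 0\<close>] .
  then show thesis
    using d that by blast
qed

lemma has_RS_integral_unique: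
  assumes I: "has_RS_integral g \<mu> a b I" and J: "has_RS_integral g \<mu> a b J"
  shows "I = J"
proof (rule ccontr)
  assume "I \<noteq> J"
  define e where "e = norm (I - J) / 2"
  have "e > 0"
    using \<open>I \<noteq> J\<close> by (simp add: e_def)
  from eventually_happens[OF eventually_conj[OF eventually_at_right_less 
      eventually_conj[OF has_RS_integral_eventually[OF I this] has_RS_integral_eventually[OF J this]]]]
  obtain d where "d > 0" and d: "\<And>\<D>. \<D> tagged_division_of {a..b} \<Longrightarrow> (\<lambda>x. ball x d) fine \<D> \<Longrightarrow>
        norm ((\<Sum>(x, K)\<in>\<D>. g x *\<^sub>R (\<mu> (Sup K) - \<mu> (Inf K))) - I) < e \<and>
        norm ((\<Sum>(x, K)\<in>\<D>. g x *\<^sub>R (\<mu> (Sup K) - \<mu> (Inf K))) - J) < e"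
    by (auto simp: trivial_limit_at_right_real)
  obtain \<D> where "\<D> tagged_division_of {a..b}" "(\<lambda>x. ball x d) fine \<D>"
    using fine_ball_division[OF \<open>d > 0\<close>] .
  note D = d[OF this]
  have "norm (I - J) < e + e"
    using D norm_triangle_ineq4[of "(\<Sum>(x, K)\<in>\<D>. g x *\<^sub>R (\<mu> (Sup K) - \<mu> (Inf K))) - J"
        "(\<Sum>(x, K)\<in>\<D>. g x *\<^sub>R (\<mu> (Sup K) - \<mu> (Inf K))) - I"] by simp
  then show False
    by (simp add: e_def)
qed

text \<open>Concatenating divisions of the two parts gives a division of the whole interval. A pair that
  belongs to both divisions has the singleton \<open>{c}\<close> as its interval and contributes zero.\<close>

lemma has_RS_integral_combine:
  assumes I1: "has_RS_integral g \<mu> a c I1" and I2: "has_RS_integral g \<mu> c b I2"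
    and I: "has_RS_integral g \<mu> a b I" and le: "a \<le> c" "c \<le> b"
  shows "I = I1 + I2"
proof (rule ccontr)
  assume "I \<noteq> I1 + I2"
  define e where "e = norm (I1 + I2 - I) / 3"
  have "e > 0"
    using \<open>I \<noteq> I1 + I2\<close> by (simp add: e_def)
  let ?S = "\<lambda>\<D>. \<Sum>(x, K)\<in>\<D>. g x *\<^sub>R (\<mu> (Sup K) - \<mu> (Inf K))"
  note ev = has_RS_integral_eventually[OF _ \<open>e > 0\<close>]
  from eventually_happens[OF eventually_conj[OF eventually_at_right_less 
      eventually_conj[OF ev[OF I1] eventually_conj[OF ev[OF I2] ev[OF I]]]]]
  obtain d where "d > 0" 
    and d1: "\<And>\<D>. \<D> tagged_division_of {a..c} \<Longrightarrow> (\<lambda>x. ball x d) fine \<D> \<Longrightarrow> norm (?S \<D> - I1) < e"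
    and d2: "\<And>\<D>. \<D> tagged_division_of {c..b} \<Longrightarrow> (\<lambda>x. ball x d) fine \<D> \<Longrightarrow> norm (?S \<D> - I2) < e"
    and d: "\<And>\<D>. \<D> tagged_division_of {a..b} \<Longrightarrow> (\<lambda>x. ball x d) fine \<D> \<Longrightarrow> norm (?S \<D> - I) < e"
    by (auto simp: trivial_limit_at_right_real)
  obtain D1 where D1: "D1 tagged_division_of {a..c}" "(\<lambda>x. ball x d) fine D1"
    using fine_ball_division[OF \<open>d > 0\<close>] .
  obtain D2 where D2: "D2 tagged_division_of {c..b}" "(\<lambda>x. ball x d) fine D2"
    using fine_ball_division[OF \<open>d > 0\<close>] .
  have "interior {a..c} \<inter> interior {c..b} = {}"
    by (auto simp: interior_atLeastAtMost_real)
  then have "D1 \<union> D2 tagged_division_of {a..c} \<union> {c..b}"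
    using D1 D2 by (intro tagged_division_Un) auto
  moreover have "{a..c} \<union> {c..b} = {a..b}"
    using le by auto
  ultimately have "D1 \<union> D2 tagged_division_of {a..b}"
    by simp
  then have "norm (?S (D1 \<union> D2) - I) < e"
    using D1 D2 by (intro d fine_Un)
  moreover have "?S (D1 \<union> D2) = ?S D1 + ?S D2"
  proof (rule sum.union_inter_neutral)
    show "finite D1" "finite D2"
      using D1 D2 by auto
    show "\<forall>p\<in>D1 \<inter> D2. (case p of (x, K) \<Rightarrow> g x *\<^sub>R (\<mu> (Sup K) - \<mu> (Inf K))) = 0"
    proof clarify
      fix x K assume "(x, K) \<in> D1" "(x, K) \<in> D2"
      then have "K \<subseteq> {a..c}" "K \<subseteq> {c..b}" "x \<in> K"
        using D1 D2 tagged_division_ofD(2,3) by metis+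
      then have "K = {c}"
        by force
      then show "g x *\<^sub>R (\<mu> (Sup K) - \<mu> (Inf K)) = 0"
        by simp
    qed
  qed
  ultimately have "norm (?S D1 + ?S D2 - I) < e"
    by simp
  then have "norm (I1 + I2 - I) < e + e + e"
    using d1[OF D1] d2[OF D2] 
      norm_triangle_ineq4[of "?S D1 + ?S D2 - I" "(?S D1 - I1) + (?S D2 - I2)"]
      norm_triangle_ineq[of "?S D1 - I1" "?S D2 - I2"]
    by (simp add: algebra_simps)
  then show False
    by (simp add: e_def)
qed

lemma has_RS_integral_atMost_unique:
  assumes "has_RS_integral_atMost g \<mu> x I" "has_RS_integral_atMost g \<mu> x J"
  shows "I = J"
proof -
  obtain G where G: "\<And>a. a \<le> x \<Longrightarrow> has_RS_integral g \<mu> a x (G a)" "(G \<longlongrightarrow> I) at_bot"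
    using assms(1) unfolding has_RS_integral_atMost_def by blast
  obtain H where H: "\<And>a. a \<le> x \<Longrightarrow> has_RS_integral g \<mu> a x (H a)" "(H \<longlongrightarrow> J) at_bot"
    using assms(2) unfolding has_RS_integral_atMost_def by blast
  have "\<forall>\<^sub>F a in at_bot. G a = H a"
    using eventually_le_at_bot[of x] by eventually_elim (rule has_RS_integral_unique[OF G(1) H(1)])
  then have "(H \<longlongrightarrow> I) at_bot"
    using G(2) by (rule Lim_transform_eventually[rotated])
  then show ?thesis
    using H(2) by (intro tendsto_unique[OF trivial_limit_at_bot_linorder])
qed

lemma has_RS_integral_increment:
  assumes "RS_integrable_UNIV g \<mu>" "c \<le> d"
  shows "has_RS_integral g \<mu> c d (RS_integral_atMost g \<mu> d - RS_integral_atMost g \<mu> c)"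
proof -
  have *: "has_RS_integral_atMost g \<mu> x (RS_integral_atMost g \<mu> x)" for x
  proof -
    obtain F where "\<forall>x. has_RS_integral_atMost g \<mu> x (F x)"
      using assms(1) unfolding RS_integrable_UNIV_def by blast
    then have F: "has_RS_integral_atMost g \<mu> x (F x)"
      by blast
    show ?thesis
      unfolding RS_integral_atMost_def
      by (rule theI[of _ "F x"]) (auto intro: F has_RS_integral_atMost_unique)
  qed
  obtain G where G: "\<And>a. a \<le> c \<Longrightarrow> has_RS_integral g \<mu> a c (G a)" 
      "(G \<longlongrightarrow> RS_integral_atMost g \<mu> c) at_bot"
    using *[of c] unfolding has_RS_integral_atMost_def by blast
  obtain H where H: "\<And>a. a \<le> d \<Longrightarrow> has_RS_integral g \<mu> a d (H a)" 
      "(H \<longlongrightarrow> RS_integral_atMost g \<mu> d) at_bot"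
    using *[of d] unfolding has_RS_integral_atMost_def by blast
  have ev: "\<forall>\<^sub>F a in at_bot. H a - G a = H c"
    using eventually_le_at_bot[of c]
  proof eventually_elim
    case (elim a)
    then show ?case
      using has_RS_integral_combine[OF G(1)[of a] H(1)[of c] H(1)[of a]] assms(2) by simp
  qed
  have lim: "((\<lambda>a. H a - G a) \<longlongrightarrow> RS_integral_atMost g \<mu> d - RS_integral_atMost g \<mu> c) at_bot"
    by (intro tendsto_diff G H)
  have "((\<lambda>a :: real. H c) \<longlongrightarrow> RS_integral_atMost g \<mu> d - RS_integral_atMost g \<mu> c) at_bot"
    by (rule Lim_transform_eventually[OF lim ev])
  then have "RS_integral_atMost g \<mu> d - RS_integral_atMost g \<mu> c = H c"
    by (simp add: tendsto_const_iff)
  then show ?thesis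
    using H(1)[OF assms(2)] by simp
qed

text \<open>A scalar functional turns \<open>\<mu>\<close> into a monotone function, for which the Riemann--Stieltjes sums
  telescope once the integrand is replaced by a constant bound.\<close>

lemma has_RS_integral_bounds:
  fixes \<mu> :: "real \<Rightarrow> 'a::real_normed_vector" and \<psi> :: "'a \<Rightarrow> real"
  assumes I: "has_RS_integral g \<mu> c d I" and cd: "c \<le> d"
    and \<psi>: "bounded_linear \<psi>" and mono: "mono (\<lambda>t. \<psi> (\<mu> t))"
    and g: "\<And>t. t \<in> {c..d} \<Longrightarrow> \<alpha> \<le> g t" "\<And>t. t \<in> {c..d} \<Longrightarrow> g t \<le> \<beta>"
  shows "\<alpha> * \<psi> (\<mu> d - \<mu> c) \<le> \<psi> I" "\<psi> I \<le> \<beta> * \<psi> (\<mu> d - \<mu> c)"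
proof -
  interpret bounded_linear \<psi> by fact
  define T where "T = {y. \<alpha> * \<psi> (\<mu> d - \<mu> c) \<le> \<psi> y \<and> \<psi> y \<le> \<beta> * \<psi> (\<mu> d - \<mu> c)}"
  have "\<exists>y\<in>T. dist y I < e" if "e > 0" for e
  proof -
    obtain \<D> where D: "\<D> tagged_division_of {c..d}"
      "norm ((\<Sum>(x, K)\<in>\<D>. g x *\<^sub>R (\<mu> (Sup K) - \<mu> (Inf K))) - I) < e"
      using has_RS_integral_approx[OF I \<open>e > 0\<close>] .
    have K: "x \<in> {c..d}" "0 \<le> \<psi> (\<mu> (Sup K)) - \<psi> (\<mu> (Inf K))" if xK: "(x, K) \<in> \<D>" for x K
    proof -
      obtain u v where "K = {u..v}" "x \<in> K" "K \<subseteq> {c..d}"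
        using tagged_division_ofD(2,3,4)[OF D(1) xK] by (metis box_real(2))
      then show "x \<in> {c..d}" "0 \<le> \<psi> (\<mu> (Sup K)) - \<psi> (\<mu> (Inf K))"
        using monoD[OF mono, of u v] by auto
    qed
    have tele: "(\<Sum>(x, K)\<in>\<D>. r * (\<psi> (\<mu> (Sup K)) - \<psi> (\<mu> (Inf K)))) = r * \<psi> (\<mu> d - \<mu> c)" for r
      using additive_tagged_division_1[OF cd D(1), of "\<lambda>t. r * \<psi> (\<mu> t)"]
      by (simp add: diff algebra_simps)
    define y where "y = (\<Sum>(x, K)\<in>\<D>. g x *\<^sub>R (\<mu> (Sup K) - \<mu> (Inf K)))"
    have "\<psi> y = (\<Sum>(x, K)\<in>\<D>. g x * (\<psi> (\<mu> (Sup K)) - \<psi> (\<mu> (Inf K))))"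
      by (simp add: y_def sum scaleR diff case_prod_unfold)
    moreover have "(\<Sum>(x, K)\<in>\<D>. g x * (\<psi> (\<mu> (Sup K)) - \<psi> (\<mu> (Inf K)))) \<le> 
        (\<Sum>(x, K)\<in>\<D>. \<beta> * (\<psi> (\<mu> (Sup K)) - \<psi> (\<mu> (Inf K))))"
      using K g(2) by (intro sum_mono) (auto intro!: mult_right_mono)
    moreover have "(\<Sum>(x, K)\<in>\<D>. \<alpha> * (\<psi> (\<mu> (Sup K)) - \<psi> (\<mu> (Inf K)))) \<le> 
        (\<Sum>(x, K)\<in>\<D>. g x * (\<psi> (\<mu> (Sup K)) - \<psi> (\<mu> (Inf K))))"
      using K g(1) by (intro sum_mono) (auto intro!: mult_right_mono)
    ultimately have "y \<in> T"
      by (simp add: T_def tele)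
    then show ?thesis
      using D(2) by (auto simp: y_def dist_norm)
  qed
  then have "I \<in> closure T"
    by (simp add: closure_approachable)
  moreover have "closed T"
    unfolding T_def by (intro closed_Collect_conj closed_Collect_le continuous_intros continuous_on)
  ultimately show "\<alpha> * \<psi> (\<mu> d - \<mu> c) \<le> \<psi> I" "\<psi> I \<le> \<beta> * \<psi> (\<mu> d - \<mu> c)"
    by (auto simp: T_def closure_closed)
qed

text \<open>A difference quotient over an interval that contains \<open>t\<close> is a convex combination of the two
  one-sided quotients at \<open>t\<close>, hence no derivative near \<open>t\<close> is required.\<close>

lemma has_vector_derivative_straddle:
  fixes F :: "real \<Rightarrow> 'a::real_normed_vector"
  assumes F: "(F has_vector_derivative D) (at t)"
    and lu: "\<And>n. l n \<le> t" "\<And>n. t \<le> u n" "\<And>n. l n < u n" and lim: "(\<lambda>n. u n - l n) \<longlonglongrightarrow> 0"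
  shows "(\<lambda>n. (F (u n) - F (l n)) /\<^sub>R (u n - l n)) \<longlonglongrightarrow> D"
proof (rule tendstoI)
  fix e :: real assume "e > 0"
  then have "e / 2 > 0" by simp
  then obtain d where "d > 0" and d: "\<And>y. norm (y - t) < d \<Longrightarrow> 
      norm (F y - F t - (y - t) *\<^sub>R D) \<le> e / 2 * norm (y - t)"
    using F unfolding has_vector_derivative_def has_derivative_at_alt by metis
  have "\<forall>\<^sub>F n in sequentially. u n - l n < d"
    using order_tendstoD(2)[OF lim \<open>d > 0\<close>] .
  then show "\<forall>\<^sub>F n in sequentially. dist ((F (u n) - F (l n)) /\<^sub>R (u n - l n)) D < e"
  proof eventually_elim
    case (elim n)
    have 1: "norm (F (u n) - F t - (u n - t) *\<^sub>R D) \<le> e / 2 * (u n - t)"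
      using d[of "u n"] elim lu[of n] by simp
    have 2: "norm (F (l n) - F t - (l n - t) *\<^sub>R D) \<le> e / 2 * (t - l n)"
      using d[of "l n"] elim lu[of n] by simp
    have "norm ((F (u n) - F (l n)) - (u n - l n) *\<^sub>R D) \<le> e / 2 * (u n - t) + e / 2 * (t - l n)"
    proof -
      have eq: "(F (u n) - F (l n)) - (u n - l n) *\<^sub>R D = 
          (F (u n) - F t - (u n - t) *\<^sub>R D) - (F (l n) - F t - (l n - t) *\<^sub>R D)"
        by (simp add: algebra_simps)
      show ?thesis
        unfolding eq using norm_triangle_ineq4 1 2 by (rule order_trans[OF _ add_mono])
    qed
    also have "\<dots> = e / 2 * (u n - l n)"
      by (simp flip: distrib_left)
    finally have *: "norm ((F (u n) - F (l n)) - (u n - l n) *\<^sub>R D) \<le> e / 2 * (u n - l n)" .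
    have "(F (u n) - F (l n)) /\<^sub>R (u n - l n) - D = ((F (u n) - F (l n)) - (u n - l n) *\<^sub>R D) /\<^sub>R (u n - l n)"
      using lu(3)[of n] by (simp add: scaleR_diff_right)
    then have "norm ((F (u n) - F (l n)) /\<^sub>R (u n - l n) - D) = 
        norm ((F (u n) - F (l n)) - (u n - l n) *\<^sub>R D) / (u n - l n)"
      using lu(3)[of n] by (simp only: norm_scaleR) (simp add: divide_inverse mult.commute)
    also have "\<dots> \<le> e / 2"
      using * lu(3)[of n] by (simp only: pos_divide_le_eq diff_gt_0_iff_gt)
    finally have "norm ((F (u n) - F (l n)) /\<^sub>R (u n - l n) - D) \<le> e / 2" .
    then show ?case
      using \<open>e > 0\<close> by (simp add: dist_norm)
  qed
qed

text \<open>The singular part has derivative zero almost everywhere, so \<open>\<mu>'\<close> is also the derivative of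
  \<open>\<mu>\<close> itself.\<close>

lemma ac_derivative_imp_derivative:
  assumes "ac_derivative \<mu> \<mu>'"
  shows "AE t in lebesgue. (\<mu> has_vector_derivative \<mu>' t) (at t)"
proof -
  obtain \<nu> where "AE t in lebesgue. ((\<lambda>t. \<mu> t - \<nu> t) has_vector_derivative 0) (at t)"
    "AE t in lebesgue. (\<nu> has_vector_derivative \<mu>' t) (at t)"
    using assms unfolding ac_derivative_def ac_part_def by blast
  then show ?thesis
  proof eventually_elim
    case (elim t)
    from has_vector_derivative_add[OF this] show ?case
      by simp
  qed
qed

section \<open>Integrals of functions that may take infinite values\<close>

lemma integral_ext_mono:
  assumes "\<And>t. t \<in> S \<Longrightarrow> g t \<le> h t"
  shows "integral_ext S g \<le> integral_ext S h"
  unfolding integral_ext_def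
  by (intro ereal_minus_mono nn_integral_mono less_eq_ennreal.rep_eq[THEN iffD1])
     (auto simp: indicator_def intro!: e2ennreal_mono assms)

lemma integral_ext_real:
  assumes "set_integrable lebesgue S h"
  shows "integral_ext S (\<lambda>t. ereal (h t)) = ereal (LINT t:S|lebesgue. h t)"
proof -
  let ?h = "\<lambda>t. indicator S t *\<^sub>R h t"
  have int: "integrable lebesgue ?h"
    using assms unfolding set_integrable_def .
  have pos: "(\<integral>\<^sup>+t\<in>S. e2ennreal (ereal (h t)) \<partial>lebesgue) = (\<integral>\<^sup>+t. ennreal (?h t) \<partial>lebesgue)"
    by (intro nn_integral_cong) (auto simp: indicator_def)
  have neg: "(\<integral>\<^sup>+t\<in>S. e2ennreal (- ereal (h t)) \<partial>lebesgue) = (\<integral>\<^sup>+t. ennreal (- ?h t) \<partial>lebesgue)"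
    by (intro nn_integral_cong) (auto simp: indicator_def)
  have fin: "(\<integral>\<^sup>+t. ennreal (?h t) \<partial>lebesgue) < \<infinity>" "(\<integral>\<^sup>+t. ennreal (- ?h t) \<partial>lebesgue) < \<infinity>"
    using int unfolding real_integrable_def by (auto simp: less_top)
  have conv: "enn2ereal x = ereal (enn2real x)" if "x < \<infinity>" for x
    using that by (cases x) auto
  show ?thesis
    unfolding integral_ext_def pos neg set_lebesgue_integral_def real_lebesgue_integral_def[OF int]
      conv[OF fin(1)] conv[OF fin(2)] by simp
qed

lemma limsup_enn2ereal: "limsup (\<lambda>n. enn2ereal (u n)) = enn2ereal (limsup u)"
  by (rule Limsup_compose_continuous_mono[OF continuous_on_enn2ereal])
     (auto simp: mono_def less_eq_ennreal.rep_eq)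

lemma liminf_enn2ereal: "liminf (\<lambda>n. enn2ereal (u n)) = enn2ereal (liminf u)"
  by (rule Liminf_compose_continuous_mono[OF continuous_on_enn2ereal])
     (auto simp: mono_def less_eq_ennreal.rep_eq)

text \<open>Reversed Fatou lemma: the positive parts are dominated by \<open>H\<close>, so their integrals pass to the
  limit, while Fatou's lemma applies to the negative parts, whose limit may have infinite integral.\<close>

lemma limsup_set_integral_le_integral_ext:
  fixes h :: "nat \<Rightarrow> real \<Rightarrow> real"
  assumes H: "set_integrable lebesgue S H" and h: "\<And>n. set_integrable lebesgue S (h n)"
    and le: "\<And>n t. t \<in> S \<Longrightarrow> h n t \<le> H t" 
    and lim: "AE t in lebesgue. t \<in> S \<longrightarrow> (\<lambda>n. ereal (h n t)) \<longlonglongrightarrow> g t"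
  shows "limsup (\<lambda>n. ereal (LINT t:S|lebesgue. h n t)) \<le> integral_ext S g"
proof -
  let ?p = "\<lambda>n t. ennreal (indicator S t *\<^sub>R h n t)"
  let ?m = "\<lambda>n t. ennreal (- (indicator S t *\<^sub>R h n t))"
  have [measurable]: "(\<lambda>t. indicator S t *\<^sub>R h n t) \<in> borel_measurable lebesgue" for n
    using h[of n] unfolding set_integrable_def by (rule borel_measurable_integrable)
  have [measurable]: "(\<lambda>t. indicator S t *\<^sub>R H t) \<in> borel_measurable lebesgue" 
    using H unfolding set_integrable_def by (rule borel_measurable_integrable)
  have eq: "ereal (LINT t:S|lebesgue. h n t) = enn2ereal (\<integral>\<^sup>+t. ?p n t \<partial>lebesgue) + - enn2ereal (\<integral>\<^sup>+t. ?m n t \<partial>lebesgue)" for n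
  proof -
    have "(\<integral>\<^sup>+t\<in>S. e2ennreal (ereal (h n t)) \<partial>lebesgue) = (\<integral>\<^sup>+t. ?p n t \<partial>lebesgue)"
      "(\<integral>\<^sup>+t\<in>S. e2ennreal (- ereal (h n t)) \<partial>lebesgue) = (\<integral>\<^sup>+t. ?m n t \<partial>lebesgue)"
      by (auto intro!: nn_integral_cong simp: indicator_def)
    then show ?thesis
      using integral_ext_real[OF h[of n]] by (simp add: integral_ext_def minus_ereal_def)
  qed
  have "limsup (\<lambda>n. enn2ereal (\<integral>\<^sup>+t. ?p n t \<partial>lebesgue)) = enn2ereal (limsup (\<lambda>n. \<integral>\<^sup>+t. ?p n t \<partial>lebesgue))"
    by (rule limsup_enn2ereal)
  also have "limsup (\<lambda>n. \<integral>\<^sup>+t. ?p n t \<partial>lebesgue) \<le> (\<integral>\<^sup>+t. limsup (\<lambda>n. ?p n t) \<partial>lebesgue)"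
  proof (rule nn_integral_limsup)
    show "(\<integral>\<^sup>+t. ennreal (indicator S t *\<^sub>R H t) \<partial>lebesgue) < \<infinity>"
      using H unfolding set_integrable_def real_integrable_def by (auto simp: less_top)
    show "AE t in lebesgue. ?p n t \<le> ennreal (indicator S t *\<^sub>R H t)" for n
      using le by (intro AE_I2) (auto simp: indicator_def intro!: ennreal_leI)
  qed measurable
  also have "(\<integral>\<^sup>+t. limsup (\<lambda>n. ?p n t) \<partial>lebesgue) = (\<integral>\<^sup>+t\<in>S. e2ennreal (g t) \<partial>lebesgue)"
  proof (rule nn_integral_cong_AE)
    show "AE t in lebesgue. limsup (\<lambda>n. ?p n t) = e2ennreal (g t) * indicator S t"
      using lim
    proof eventually_elim
      case (elim t)
      show ?case
      proof (cases "t \<in> S")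
        case True
        then have "(\<lambda>n. e2ennreal (ereal (h n t))) \<longlonglongrightarrow> e2ennreal (g t)"
          using elim by (intro tendsto_intros) auto
        then show ?thesis
          using True by (intro lim_imp_Limsup) auto
      qed (simp add: Limsup_const)
    qed
  qed
  finally have p: "limsup (\<lambda>n. enn2ereal (\<integral>\<^sup>+t. ?p n t \<partial>lebesgue)) \<le> enn2ereal (\<integral>\<^sup>+t\<in>S. e2ennreal (g t) \<partial>lebesgue)"
    by (simp add: less_eq_ennreal.rep_eq)
  have "(\<integral>\<^sup>+t\<in>S. e2ennreal (- g t) \<partial>lebesgue) = (\<integral>\<^sup>+t. liminf (\<lambda>n. ?m n t) \<partial>lebesgue)"
  proof (rule nn_integral_cong_AE)
    show "AE t in lebesgue. e2ennreal (- g t) * indicator S t = liminf (\<lambda>n. ?m n t)"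
      using lim
    proof eventually_elim
      case (elim t)
      show ?case
      proof (cases "t \<in> S")
        case True
        then have "(\<lambda>n. e2ennreal (- ereal (h n t))) \<longlonglongrightarrow> e2ennreal (- g t)"
          using elim by (intro tendsto_intros tendsto_uminus_ereal) auto
        then show ?thesis
          using True by (intro lim_imp_Liminf[symmetric]) auto
      qed (simp add: Liminf_const)
    qed
  qed
  also have "\<dots> \<le> liminf (\<lambda>n. \<integral>\<^sup>+t. ?m n t \<partial>lebesgue)"
    by (rule nn_integral_liminf) measurable
  finally have "enn2ereal (\<integral>\<^sup>+t\<in>S. e2ennreal (- g t) \<partial>lebesgue) \<le> liminf (\<lambda>n. enn2ereal (\<integral>\<^sup>+t. ?m n t \<partial>lebesgue))"
    by (simp add: less_eq_ennreal.rep_eq liminf_enn2ereal)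
  then have m: "limsup (\<lambda>n. - enn2ereal (\<integral>\<^sup>+t. ?m n t \<partial>lebesgue)) \<le> - enn2ereal (\<integral>\<^sup>+t\<in>S. e2ennreal (- g t) \<partial>lebesgue)"
    by (simp add: ereal_Limsup_uminus)
  have "limsup (\<lambda>n. ereal (LINT t:S|lebesgue. h n t)) \<le> 
      limsup (\<lambda>n. enn2ereal (\<integral>\<^sup>+t. ?p n t \<partial>lebesgue)) + limsup (\<lambda>n. - enn2ereal (\<integral>\<^sup>+t. ?m n t \<partial>lebesgue))"
    unfolding eq by (rule ereal_limsup_add_mono)
  also have "\<dots> \<le> integral_ext S g"
    unfolding integral_ext_def minus_ereal_def by (rule add_mono[OF p m])
  finally show ?thesis .
qed

text \<open>The upper bound is taken piecewise. Comparing with a real function first avoids additivity of the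
  extended integral over sets, where infinite values could cancel.\<close>

lemma integral_ext_le_sum:
  fixes h :: "'i \<Rightarrow> real \<Rightarrow> real"
  assumes I: "finite I" and disj: "disjoint_family_on A I" and sub: "\<And>i. i \<in> I \<Longrightarrow> A i \<subseteq> S"
    and h: "\<And>i. i \<in> I \<Longrightarrow> set_integrable lebesgue (A i) (h i)" 
    and h0: "set_integrable lebesgue (S - (\<Union>i\<in>I. A i)) h0"
    and le: "\<And>i t. i \<in> I \<Longrightarrow> t \<in> A i \<Longrightarrow> g t \<le> ereal (h i t)" 
    and le0: "\<And>t. t \<in> S \<Longrightarrow> t \<notin> (\<Union>i\<in>I. A i) \<Longrightarrow> g t \<le> ereal (h0 t)"
  shows "integral_ext S g \<le> 
    ereal ((\<Sum>i\<in>I. LINT t:A i|lebesgue. h i t) + (LINT t:S - (\<Union>i\<in>I. A i)|lebesgue. h0 t))"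
proof -
  define H where "H t = (\<Sum>i\<in>I. indicator (A i) t *\<^sub>R h i t) + indicator (S - (\<Union>i\<in>I. A i)) t *\<^sub>R h0 t" for t
  have S: "indicator S t *\<^sub>R H t = H t" for t
  proof (cases "t \<in> S")
    case False
    then have "t \<notin> A i" if "i \<in> I" for i
      using sub[OF that] by blast
    then have "H t = 0"
      using False by (auto simp: H_def intro!: sum.neutral)
    then show ?thesis by simp
  qed simp
  have int: "integrable lebesgue H"
    unfolding H_def using h h0 by (auto simp: set_integrable_def)
  have HA: "H t = h i t" if "i \<in> I" "t \<in> A i" for i t
  proof -
    have "t \<notin> A j" if "j \<in> I" "j \<noteq> i" for j
      using disj that \<open>i \<in> I\<close> \<open>t \<in> A i\<close> by (auto simp: disjoint_family_on_def)
    then have "(\<Sum>j\<in>I. indicator (A j) t *\<^sub>R h j t) = (\<Sum>j\<in>I. if j = i then h i t else 0)"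
      using that by (intro sum.cong) auto
    moreover have "indicator (S - (\<Union>i\<in>I. A i)) t = (0 :: real)"
      using that by (auto simp: indicator_def)
    ultimately show ?thesis
      using that I by (simp add: H_def)
  qed
  have "integral_ext S g \<le> integral_ext S (\<lambda>t. ereal (H t))"
  proof (rule integral_ext_mono)
    fix t assume "t \<in> S"
    show "g t \<le> ereal (H t)"
    proof (cases "t \<in> (\<Union>i\<in>I. A i)")
      case True
      then obtain i where "i \<in> I" "t \<in> A i"
        by blast
      then show ?thesis
        using le[of i t] HA[of i t] by simp
    next
      case False
      then have "H t = h0 t"
        using \<open>t \<in> S\<close> by (auto simp: H_def intro!: sum.neutral)
      then show ?thesis
        using le0[OF \<open>t \<in> S\<close> False] by simp
    qed
  qed
  also have "\<dots> = ereal (LINT t:S|lebesgue. H t)"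
    by (rule integral_ext_real) (unfold set_integrable_def S, rule int)
  also have "(LINT t:S|lebesgue. H t) = 
      (\<Sum>i\<in>I. LINT t:A i|lebesgue. h i t) + (LINT t:S - (\<Union>i\<in>I. A i)|lebesgue. h0 t)"
    unfolding set_lebesgue_integral_def S unfolding H_def using h h0
    by (subst Bochner_Integration.integral_add) (auto simp: set_integrable_def)
  finally show ?thesis .
qed

lemma integrable_inverse_one_plus_square: "integrable lebesgue (\<lambda>t::real. 1 / (1 + t\<^sup>2))"
proof -
  have "integrable lborel (\<lambda>t::real. inverse (1 + t\<^sup>2))"
    using integrable_inverse_1_plus_square by (simp add: set_integrable_def einterval_def)
  then show ?thesis
    by (simp add: integrable_completion inverse_eq_divide)
qed

lemma tendsto_ln_ext:
  assumes "\<And>n. x n > 0" "x \<longlonglongrightarrow> y"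
  shows "(\<lambda>n. ereal (ln (x n))) \<longlonglongrightarrow> ln_ext y"
proof (cases "y > 0")
  case True
  then show ?thesis
    using assms by (auto simp: ln_ext_def intro!: tendsto_intros)
next
  case False
  have "y \<ge> 0"
    using assms by (intro LIMSEQ_le_const) (auto intro: less_imp_le)
  with False have "y = 0" by simp
  moreover have "x n \<noteq> 0" for n
    using assms(1)[of n] by simp
  ultimately have "filterlim x (at_right 0) sequentially"
    using assms by (simp add: filterlim_at)
  then have "filterlim (\<lambda>n. ln (x n)) at_bot sequentially"
    by (rule filterlim_compose[OF ln_at_0])
  then have "(\<lambda>n. ereal (ln (x n))) \<longlonglongrightarrow> - \<infinity>"
    by (auto simp: tendsto_MInfty filterlim_at_bot_dense)
  then show ?thesis
    using False by (simp add: ln_ext_def)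
qed

section \<open>Step functions on uniform partitions\<close>

definition wt :: "real \<Rightarrow> real" where "wt t = 1 / (1 + t\<^sup>2)"

lemma wt_pos: "wt t > 0"
  by (simp add: wt_def add_pos_nonneg)

lemma continuous_on_wt: "continuous_on A wt"
  unfolding wt_def by (intro continuous_intros) (auto simp: add_nonneg_eq_0_iff)

lemma UN_uniform_cells:
  fixes x :: "nat \<Rightarrow> real"
  assumes "mono x"
  shows "(\<Union>j<N. {x j<..x (Suc j)}) = {x 0<..x N}"
proof (induction N)
  case (Suc N)
  then show ?case
    using monoD[OF assms, of 0 N] monoD[OF assms, of N "Suc N"] by (auto simp: lessThan_Suc)
qed simp

lemma disjoint_cells:
  fixes x :: "nat \<Rightarrow> real"
  assumes "mono x"
  shows "disjoint_family_on (\<lambda>j. {x j<..x (Suc j)}) I"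
proof -
  have "{x i<..x (Suc i)} \<inter> {x j<..x (Suc j)} = {}" if "i < j" for i j
    using monoD[OF assms, of "Suc i" j] that by auto
  then show ?thesis
    unfolding disjoint_family_on_def by (metis Int_commute linorder_neqE_nat)
qed

lemma positive_continuous_ratio:
  fixes g :: "real \<Rightarrow> real"
  assumes cont: "continuous_on {c..d} g" and pos: "\<And>t. t \<in> {c..d} \<Longrightarrow> g t > 0" and "\<eta> > 0"
  obtains e where "e > 0"
    "\<And>s t. s \<in> {c..d} \<Longrightarrow> t \<in> {c..d} \<Longrightarrow> \<bar>s - t\<bar> < e \<Longrightarrow> g s \<le> exp \<eta> * g t"
proof -
  have "continuous_on {c..d} (\<lambda>t. ln (g t))"
    using pos by (intro continuous_on_ln cont) force
  then have "uniformly_continuous_on {c..d} (\<lambda>t. ln (g t))"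
    by (intro compact_uniformly_continuous) auto
  then obtain e where "e > 0" and e: "\<And>s t. s \<in> {c..d} \<Longrightarrow> t \<in> {c..d} \<Longrightarrow> dist s t < e \<Longrightarrow> 
      dist (ln (g s)) (ln (g t)) < \<eta>"
    using \<open>\<eta> > 0\<close> unfolding uniformly_continuous_on_def by metis
  show thesis
  proof (rule that[OF \<open>e > 0\<close>])
    fix s t assume st: "s \<in> {c..d}" "t \<in> {c..d}" "\<bar>s - t\<bar> < e"
    then have "ln (g s) \<le> \<eta> + ln (g t)"
      using e[of s t] by (simp add: dist_real_def)
    then have "exp (ln (g s)) \<le> exp (\<eta> + ln (g t))"
      by simp
    then show "g s \<le> exp \<eta> * g t"
      using pos st by (simp add: exp_add)
  qed
qed

text \<open>All that the argument uses of the Stieltjes integral is collected here: \<open>m\<close> stands for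
  \<open>x \<mapsto> \<integral>\<^bsub>-\<infinity>\<^esub>\<^bsup>x\<^esup> (1 + t\<^sup>2)\<^sup>-\<^sup>1 d\<mu>(t)\<close>, and only its increments occur, compared with those of \<open>\<mu>\<close> through
  positive functionals. Taking increments removes the matrix \<open>\<gamma>\<close>, the mass escaping to \<open>-\<infinity>\<close>.\<close>

locale weak_limit =
  fixes \<mu> m :: "real \<Rightarrow> complex^'p^'p" and P :: "nat \<Rightarrow> real \<Rightarrow> complex^'p^'p"
    and M F :: real and f :: "real \<Rightarrow> real"
  assumes f_cont: "continuous_on UNIV f" and f_pos: "\<And>t. f t > 0" and f_le: "\<And>t. f t \<le> F"
    and P_psd: "\<And>k t. pos_semidef (P k t)"
    and W_int: "\<And>k. integrable lebesgue (\<lambda>t. wt t *\<^sub>R P k t)"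
    and W_bound: "\<And>k. Re (trace (LINT t|lebesgue. wt t *\<^sub>R P k t)) \<le> M"
    and W_lim: "\<And>c d. c \<le> d \<Longrightarrow> 
      (\<lambda>k. LINT t:{c<..d}|lebesgue. wt t *\<^sub>R P k t) \<longlonglongrightarrow> m d - m c"
    and \<mu>_psd: "\<And>s t. s \<le> t \<Longrightarrow> pos_semidef (\<mu> t - \<mu> s)"
    and \<mu>_m: "\<And>c d \<alpha> \<beta> \<psi>. c \<le> d \<Longrightarrow> bounded_linear \<psi> \<Longrightarrow> 
        (\<And>A. pos_semidef A \<Longrightarrow> 0 \<le> (\<psi> A :: real)) \<Longrightarrow>
        (\<And>t. t \<in> {c..d} \<Longrightarrow> \<alpha> \<le> wt t \<and> wt t \<le> \<beta>) \<Longrightarrow>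
        \<alpha> * \<psi> (\<mu> d - \<mu> c) \<le> \<psi> (m d - m c) \<and> \<psi> (m d - m c) \<le> \<beta> * \<psi> (\<mu> d - \<mu> c)"
begin

abbreviation W where "W k t \<equiv> wt t *\<^sub>R P k t"

definition \<sigma> where "\<sigma> A = (LINT t:A|lebesgue. f t * wt t)"

lemma F_pos: "F > 0"
  using f_pos[of 0] f_le[of 0] by linarith

lemma f_measurable [measurable]: "f \<in> borel_measurable lebesgue"
  using borel_measurable_continuous_onI[OF f_cont] by (simp add: measurable_completion)

lemma f_mult_integrable:
  fixes g :: "real \<Rightarrow> real"
  assumes "integrable lebesgue g"
  shows "integrable lebesgue (\<lambda>t. f t * g t)"
proof (rule Bochner_Integration.integrable_bound[of _ "\<lambda>t. F * g t"])
  have [measurable]: "g \<in> borel_measurable lebesgue"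
    using assms by (rule borel_measurable_integrable)
  show "(\<lambda>t. f t * g t) \<in> borel_measurable lebesgue"
    by measurable
  show "AE t in lebesgue. norm (f t * g t) \<le> norm (F * g t)"
    using f_le f_pos F_pos by (intro AE_I2) (auto simp: abs_mult less_imp_le intro!: mult_right_mono)
qed (use assms in simp)

lemma set_integrableI: 
  fixes g :: "real \<Rightarrow> 'b::{banach,second_countable_topology}"
  assumes "integrable lebesgue g" "A \<in> sets lebesgue"
  shows "set_integrable lebesgue A g"
  using assms unfolding set_integrable_def by (intro integrable_mult_indicator)

lemma fw_integrable: "A \<in> sets lebesgue \<Longrightarrow> set_integrable lebesgue A (\<lambda>t. f t * wt t)"
  using integrable_inverse_one_plus_square
  by (intro set_integrableI f_mult_integrable) (simp add: wt_def)

lemma \<sigma>_mono: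
  assumes "A \<in> sets lebesgue" "B \<in> sets lebesgue" "A \<subseteq> B"
  shows "\<sigma> A \<le> \<sigma> B"
  unfolding \<sigma>_def set_lebesgue_integral_def
  using fw_integrable[OF assms(1)] fw_integrable[OF assms(2)] assms(3) f_pos wt_pos
  by (intro integral_mono) (auto simp: set_integrable_def indicator_def less_imp_le)

lemma \<sigma>_nonneg: "0 \<le> \<sigma> A"
  unfolding \<sigma>_def set_lebesgue_integral_def using f_pos wt_pos 
  by (intro integral_nonneg_AE AE_I2) (simp add: less_imp_le)

lemma fW_integrable:
  assumes "bounded_linear \<psi>" "A \<in> sets lebesgue"
  shows "set_integrable lebesgue A (\<lambda>t. f t * \<psi> (W k t))"
  by (intro set_integrableI f_mult_integrable integrable_bounded_linear[OF assms(1) W_int] assms(2))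

lemma fW_integral_le:
  assumes \<psi>: "bounded_linear \<psi>" and pos: "\<And>A. pos_semidef A \<Longrightarrow> 0 \<le> (\<psi> A :: real)"
    and A: "A \<in> sets lebesgue" and B: "\<And>t. t \<in> A \<Longrightarrow> f t \<le> B"
  shows "(LINT t:A|lebesgue. f t * \<psi> (W k t)) \<le> B * \<psi> (LINT t:A|lebesgue. W k t)"
proof -
  interpret bounded_linear \<psi> by fact
  have int: "integrable lebesgue (\<lambda>t. indicator A t *\<^sub>R W k t)"
    using W_int A by (intro integrable_mult_indicator)
  have nonneg: "0 \<le> \<psi> (W k t)" for t
    using pos[OF P_psd[of k t]] wt_pos[of t] by (simp add: scaleR)
  have "(LINT t:A|lebesgue. f t * \<psi> (W k t)) \<le> (LINT t|lebesgue. B * \<psi> (indicator A t *\<^sub>R W k t))"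
    unfolding set_lebesgue_integral_def
  proof (rule integral_mono)
    show "integrable lebesgue (\<lambda>t. indicator A t *\<^sub>R (f t * \<psi> (W k t)))"
      using fW_integrable[OF \<psi> A] by (simp add: set_integrable_def)
    show "integrable lebesgue (\<lambda>t. B * \<psi> (indicator A t *\<^sub>R W k t))"
      by (intro integrable_mult_right integrable_bounded_linear[OF \<psi>] int)
    show "indicator A t *\<^sub>R (f t * \<psi> (W k t)) \<le> B * \<psi> (indicator A t *\<^sub>R W k t)" for t
      using B[of t] nonneg[of t] by (cases "t \<in> A") (auto intro: mult_right_mono simp: zero)
  qed
  also have "\<dots> = B * \<psi> (LINT t:A|lebesgue. W k t)"
    unfolding set_lebesgue_integral_def 
    by (simp only: integral_mult_right_zero integral_bounded_linear[OF \<psi> int])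
  finally show ?thesis .
qed

lemma trace_set_integral_le:
  assumes A: "A \<in> sets lebesgue"
  shows "Re (trace (LINT t:A|lebesgue. W k t)) \<le> M"
proof -
  note tr = bounded_linear_Re_trace
  have int: "integrable lebesgue (\<lambda>t. indicator A t *\<^sub>R W k t)"
    using W_int A by (intro integrable_mult_indicator)
  have nonneg: "0 \<le> Re (trace (W k t))" for t
    using pos_semidef_trace_nonneg[OF P_psd[of k t]] wt_pos[of t]
    by (simp add: bounded_linear_scale[OF tr])
  have "Re (trace (LINT t:A|lebesgue. W k t)) = (LINT t|lebesgue. Re (trace (indicator A t *\<^sub>R W k t)))"
    unfolding set_lebesgue_integral_def by (rule integral_bounded_linear[OF tr int, symmetric])
  also have "\<dots> \<le> (LINT t|lebesgue. Re (trace (W k t)))"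
  proof (rule integral_mono)
    show "Re (trace (indicator A t *\<^sub>R W k t)) \<le> Re (trace (W k t))" for t
      using nonneg[of t] by (cases "t \<in> A") (simp_all add: linear_0[OF bounded_linear.linear[OF tr]] trace_0[unfolded mat_0])
  qed (intro integrable_bounded_linear[OF tr] int W_int)+
  also have "\<dots> \<le> M"
    using W_bound[of k] by (simp add: integral_bounded_linear[OF tr W_int])
  finally show ?thesis .
qed

lemma trace_increment_le:
  assumes "c \<le> d"
  shows "Re (trace (m d - m c)) \<le> M"
  by (rule LIMSEQ_le_const2[OF bounded_linear.tendsto[OF bounded_linear_Re_trace W_lim[OF assms]]])
     (auto intro!: trace_set_integral_le)

abbreviation log_int where "log_int S k \<equiv> integral_ext S (\<lambda>t. ereal (f t * wt t) * ln_ext (Re (det (P k t))))"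

lemma integrand_le:
  assumes \<psi>: "bounded_linear \<psi>" and le: "ln_ext (Re (det (P k t))) \<le> ereal (\<psi> (P k t) + r)"
  shows "ereal (f t * wt t) * ln_ext (Re (det (P k t))) \<le> ereal (f t * \<psi> (W k t) + r * (f t * wt t))"
proof -
  have "ereal (f t * wt t) * ln_ext (Re (det (P k t))) \<le> ereal (f t * wt t) * ereal (\<psi> (P k t) + r)"
    using f_pos wt_pos by (intro ereal_mult_left_mono le) (simp add: less_imp_le)
  also have "\<dots> = ereal (f t * \<psi> (W k t) + r * (f t * wt t))"
    by (simp add: bounded_linear_scale[OF \<psi>] algebra_simps)
  finally show ?thesis .
qed

lemma affine_integral:
  assumes "bounded_linear \<psi>" "A \<in> sets lebesgue"
  shows "set_integrable lebesgue A (\<lambda>t. f t * \<psi> (W k t) + r * (f t * wt t))"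
    and "(LINT t:A|lebesgue. f t * \<psi> (W k t) + r * (f t * wt t)) = 
      (LINT t:A|lebesgue. f t * \<psi> (W k t)) + r * \<sigma> A"
  using fW_integrable[OF assms, of k] fw_integrable[OF assms(2)]
  by (auto simp: \<sigma>_def intro!: set_integral_add)

text \<open>The bound obtained from one uniform partition of \<open>(c, d]\<close> into \<open>N\<close> cells. The factor \<open>q\<close> controls
  the oscillation of \<open>f\<close> and of the weight within a cell; it is multiplicative, so that errors are
  proportional to the measure with density \<open>f / (1 + t\<^sup>2)\<close>. The term \<open>\<epsilon> F M\<close> comes from the complement
  of \<open>(c, d]\<close>, and \<open>\<epsilon> F M q\<^sup>2\<close> from truncating the cell values at \<open>R\<close>.\<close>

lemma step_estimate:
  fixes c d \<delta> \<epsilon> q :: real and N :: nat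
  defines "h \<equiv> (d - c) / real N"
  defines "x \<equiv> \<lambda>j :: nat. c + real j * h"
  defines "B \<equiv> \<lambda>j. (\<mu> (x (Suc j)) - \<mu> (x j)) /\<^sub>R h + \<delta> *\<^sub>R mat 1"
  defines "p \<equiv> real CARD('p)"
  defines "R \<equiv> - p * (1 + ln \<epsilon>)"
  assumes cd: "c < d" and N: "N > 0" and S: "S \<in> sets lebesgue" "{c<..d} \<subseteq> S" and q: "q \<ge> 1" 
    and \<delta>: "\<delta> > 0" and \<epsilon>: "\<epsilon> > 0"
    and osc: "\<And>s t. s \<in> {c..d} \<Longrightarrow> t \<in> {c..d} \<Longrightarrow> \<bar>s - t\<bar> \<le> h \<Longrightarrow> f s \<le> q * f t \<and> wt s \<le> q * wt t"
  shows "limsup (log_int S) \<le> 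
    ereal ((\<Sum>j<N. min (ln (Re (det (B j)))) R * \<sigma> {x j<..x (Suc j)}) + 
      ((p * (q^4 - 1) + \<epsilon> * \<delta> * p) * \<sigma> UNIV + \<epsilon> * F * M * (1 + q\<^sup>2) + R * \<sigma> (S - {c<..d})))"
proof -
  have h: "h > 0"
    using cd N by (simp add: h_def)
  have x0: "x 0 = c" and xN: "x N = d" and xS: "x (Suc j) = x j + h" for j
    using N by (simp_all add: x_def h_def distrib_right add_divide_distrib)
  have "mono x"
    using h by (auto simp: mono_def x_def intro!: mult_right_mono)
  define I where "I j = {x j<..x (Suc j)}" for j
  have UI: "(\<Union>j<N. I j) = {c<..d}"
    unfolding I_def UN_uniform_cells[OF \<open>mono x\<close>] x0 xN ..
  have disj: "disjoint_family_on I {..<N}"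
    unfolding I_def by (rule disjoint_cells[OF \<open>mono x\<close>])
  have Isets: "I j \<in> sets lebesgue" for j
    by (simp add: I_def)
  have xj: "x j \<in> {c..d}" if "j \<le> N" for j
    using monoD[OF \<open>mono x\<close>, of 0 j] monoD[OF \<open>mono x\<close>, of j N] that by (simp add: x0 xN)
  have cell: "t \<in> {c..d} \<and> \<bar>t - x j\<bar> \<le> h \<and> \<bar>x j - t\<bar> \<le> h" if "t \<in> {x j..x (Suc j)}" "j < N" for t j
    using xj[of j] xj[of "Suc j"] that xS[of j] by auto
  define D where "D j = (\<mu> (x (Suc j)) - \<mu> (x j)) /\<^sub>R h" for j
  have Dpsd: "pos_semidef (D j)" for j
  proof -
    have "pos_semidef (\<mu> (x (Suc j)) - \<mu> (x j))"
      using h by (intro \<mu>_psd) (simp add: xS)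
    then show ?thesis
      using h unfolding D_def by (intro pos_semidef_scaleR) auto
  qed
  have BD: "B j = D j + \<delta> *\<^sub>R mat 1" for j
    by (simp add: B_def D_def)
  define l where "l j = ln (Re (det (B j)))" for j
  have "\<exists>\<psi> :: complex^'p^'p \<Rightarrow> real. bounded_linear \<psi> \<and> (\<forall>A. pos_semidef A \<longrightarrow> 0 \<le> \<psi> A) \<and> 
      \<psi> (D j) \<le> p \<and> (\<forall>A. pos_semidef A \<longrightarrow> ln_ext (Re (det A)) \<le> ereal (\<psi> A - p + l j))" for j
    using log_det_tangent(2)[OF Dpsd[of j] \<delta>] unfolding p_def l_def BD .
  then obtain \<psi> :: "nat \<Rightarrow> complex^'p^'p \<Rightarrow> real" where \<psi>: "\<And>j. bounded_linear (\<psi> j)"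
    and \<psi>_pos: "\<And>j A. pos_semidef A \<Longrightarrow> 0 \<le> \<psi> j A" and \<psi>D: "\<And>j. \<psi> j (D j) \<le> p" 
    and \<psi>_ln: "\<And>j A. pos_semidef A \<Longrightarrow> ln_ext (Re (det A)) \<le> ereal (\<psi> j A - p + l j)"
    by metis
  \<comment> \<open>The functional of the tangent at the multiple \<open>1/\<epsilon>\<close> of the identity.\<close>
  define \<tau> where "\<tau> A = \<epsilon> * Re (trace A)" for A :: "complex^'p^'p"
  have \<tau>: "bounded_linear \<tau>" 
    unfolding \<tau>_def using bounded_linear_Re_trace by (rule bounded_linear_const_mult)
  have \<tau>_pos: "0 \<le> \<tau> A" if "pos_semidef A" for A
    using \<epsilon> pos_semidef_trace_nonneg[OF that] by (simp add: \<tau>_def)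
  have \<tau>_ln: "ln_ext (Re (det A)) \<le> ereal (\<tau> A + R)" if "pos_semidef A" for A
    using log_det_le_trace[OF that \<epsilon>] by (simp add: \<tau>_def R_def p_def)

  define a where "a V = (\<Sum>j<N. q * f (x j) * \<psi> j (V j) + (l j - p) * \<sigma> (I j)) + 
      (\<epsilon> * F * M + R * \<sigma> (S - {c<..d}))" for V :: "nat \<Rightarrow> complex^'p^'p"
  have "log_int S k \<le> ereal (a (\<lambda>j. LINT t:I j|lebesgue. W k t))" for k
  proof -
    have "log_int S k \<le> ereal ((\<Sum>j<N. LINT t:I j|lebesgue. f t * \<psi> j (W k t) + (l j - p) * (f t * wt t)) + 
        (LINT t:S - (\<Union>j<N. I j)|lebesgue. f t * \<tau> (W k t) + R * (f t * wt t)))"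
    proof (rule integral_ext_le_sum)
      show "I j \<subseteq> S" if "j \<in> {..<N}" for j
        using UI that S(2) by blast
      show "set_integrable lebesgue (S - (\<Union>j<N. I j)) (\<lambda>t. f t * \<tau> (W k t) + R * (f t * wt t))"
        using S(1) Isets by (intro affine_integral(1) \<tau>) auto
      show "ereal (f t * wt t) * ln_ext (Re (det (P k t))) \<le> ereal (f t * \<psi> j (W k t) + (l j - p) * (f t * wt t))" for t j
        using \<psi>_ln[OF P_psd] by (intro integrand_le \<psi>) (simp add: algebra_simps)
      show "ereal (f t * wt t) * ln_ext (Re (det (P k t))) \<le> ereal (f t * \<tau> (W k t) + R * (f t * wt t))" for t
        by (intro integrand_le \<tau> \<tau>_ln P_psd)
    qed (auto intro: disj affine_integral(1) \<psi> Isets)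
    also have "\<dots> \<le> ereal (a (\<lambda>j. LINT t:I j|lebesgue. W k t))"
      unfolding ereal_less_eq a_def UI
    proof (intro add_mono sum_mono)
      fix j assume "j \<in> {..<N}"
      then have "f t \<le> q * f (x j)" if "t \<in> I j" for t
        using osc[of t "x j"] cell[of t j] xj[of j] that by (auto simp: I_def)
      from fW_integral_le[OF \<psi> \<psi>_pos Isets this]
      show "(LINT t:I j|lebesgue. f t * \<psi> j (W k t) + (l j - p) * (f t * wt t)) \<le> 
          q * f (x j) * \<psi> j (LINT t:I j|lebesgue. W k t) + (l j - p) * \<sigma> (I j)"
        by (simp add: affine_integral(2)[OF \<psi> Isets])
    next
      have A: "S - {c<..d} \<in> sets lebesgue"
        using S by (intro sets.Diff) auto
      have "(LINT t:S - {c<..d}|lebesgue. f t * \<tau> (W k t)) \<le> F * \<tau> (LINT t:S - {c<..d}|lebesgue. W k t)"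
        by (intro fW_integral_le \<tau> \<tau>_pos A f_le)
      also have "\<dots> \<le> \<epsilon> * F * M"
        using F_pos \<epsilon> trace_set_integral_le[OF A, of k] by (simp add: \<tau>_def)
      finally show "(LINT t:S - {c<..d}|lebesgue. f t * \<tau> (W k t) + R * (f t * wt t)) \<le> 
          \<epsilon> * F * M + R * \<sigma> (S - {c<..d})"
        by (simp add: affine_integral(2)[OF \<tau> A])
    qed
    finally show ?thesis .
  qed
  then have "limsup (log_int S) \<le> limsup (\<lambda>k. ereal (a (\<lambda>j. LINT t:I j|lebesgue. W k t)))"
    by (intro Limsup_mono always_eventually allI)
  also have "\<dots> = ereal (a (\<lambda>j. m (x (Suc j)) - m (x j)))"
  proof (intro lim_imp_Limsup)
    have "(\<lambda>k. LINT t:I j|lebesgue. W k t) \<longlonglongrightarrow> m (x (Suc j)) - m (x j)" for j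
      unfolding I_def using h by (intro W_lim) (simp add: xS)
    then show "(\<lambda>k. ereal (a (\<lambda>j. LINT t:I j|lebesgue. W k t))) \<longlonglongrightarrow> ereal (a (\<lambda>j. m (x (Suc j)) - m (x j)))"
      unfolding a_def by (intro tendsto_intros bounded_linear.tendsto[OF \<psi>])
  qed simp
  finally have lim: "limsup (log_int S) \<le> ereal (a (\<lambda>j. m (x (Suc j)) - m (x j)))" .

  have \<sigma>I: "(\<Sum>j<N. \<sigma> (I j)) \<le> \<sigma> UNIV"
  proof -
    have "(\<Sum>j<N. \<sigma> (I j)) = \<sigma> (\<Union>j<N. I j)"
      unfolding \<sigma>_def using disj Isets fw_integrable by (intro set_integral_finite_Union[symmetric]) auto
    then show ?thesis
      using \<sigma>_mono[of "\<Union>j<N. I j" UNIV] UI by simp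
  qed
  have \<sigma>_upper: "\<sigma> (I j) \<le> C * h" if "\<And>t. t \<in> I j \<Longrightarrow> f t * wt t \<le> C" for j C
  proof -
    have "\<sigma> (I j) \<le> (LINT t:I j|lebesgue. C)"
      unfolding \<sigma>_def using that h fw_integrable[OF Isets]
      by (intro set_integral_mono) (auto simp: I_def set_integrable_def xS)
    then show ?thesis
      using h by (simp add: I_def set_lebesgue_integral_def xS mult.commute)
  qed
  have \<sigma>_lower: "C * h \<le> \<sigma> (I j)" if "\<And>t. t \<in> I j \<Longrightarrow> C \<le> f t * wt t" for j C
  proof -
    have "(LINT t:I j|lebesgue. C) \<le> \<sigma> (I j)"
      unfolding \<sigma>_def using that h fw_integrable[OF Isets]
      by (intro set_integral_mono) (auto simp: I_def set_integrable_def xS)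
    then show ?thesis
      using h by (simp add: I_def set_lebesgue_integral_def xS mult.commute)
  qed
  have hD: "h *\<^sub>R D j = \<mu> (x (Suc j)) - \<mu> (x j)" for j
    using h by (simp add: D_def)

  \<comment> \<open>Two factors \<open>q\<close> bound \<open>f\<close> and the weight on the cell by their values at \<open>x j\<close>, two more
    compare these values with the integral over the cell.\<close>
  have tangent_part: "q * f (x j) * \<psi> j (m (x (Suc j)) - m (x j)) \<le> p * q^4 * \<sigma> (I j)" if "j < N" for j
  proof -
    have "\<psi> j (m (x (Suc j)) - m (x j)) \<le> q * wt (x j) * \<psi> j (\<mu> (x (Suc j)) - \<mu> (x j))"
    proof -
      have "0 \<le> wt t \<and> wt t \<le> q * wt (x j)" if "t \<in> {x j..x (Suc j)}" for t
        using osc[of t "x j"] cell[of t j] xj[of j] that \<open>j < N\<close> wt_pos[of t] by auto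
      from \<mu>_m[OF _ \<psi>[of j] \<psi>_pos this] show ?thesis
        using h by (simp add: xS)
    qed
    also have "\<psi> j (\<mu> (x (Suc j)) - \<mu> (x j)) = h * \<psi> j (D j)"
      unfolding hD[symmetric] by (simp add: bounded_linear_scale[OF \<psi>])
    also have "q * wt (x j) * (h * \<psi> j (D j)) \<le> q * wt (x j) * (h * p)"
      using q h wt_pos[of "x j"] \<psi>D[of j] by (intro mult_left_mono) auto
    finally have "q * f (x j) * \<psi> j (m (x (Suc j)) - m (x j)) \<le> q * f (x j) * (q * wt (x j) * (h * p))"
      using q f_pos[of "x j"] by (intro mult_left_mono) auto
    also have "\<dots> = p * q^4 * ((f (x j) * wt (x j) / q\<^sup>2) * h)"
      using q by (simp add: power2_eq_square power4_eq_xxxx)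
    also have "\<dots> \<le> p * q^4 * \<sigma> (I j)"
    proof (intro mult_left_mono \<sigma>_lower)
      fix t assume "t \<in> I j"
      then have "f (x j) \<le> q * f t" "wt (x j) \<le> q * wt t"
        using osc[of "x j" t] cell[of t j] xj[of j] that by (auto simp: I_def)
      then have "f (x j) * wt (x j) \<le> (q * f t) * (q * wt t)"
        using f_pos wt_pos q by (intro mult_mono) (auto simp: less_imp_le)
      then show "f (x j) * wt (x j) / q\<^sup>2 \<le> f t * wt t"
        using q by (simp add: divide_le_eq power2_eq_square algebra_simps)
    qed (use q in \<open>auto simp: p_def\<close>)
    finally show ?thesis .
  qed
  \<comment> \<open>The excess of \<open>l j\<close> over \<open>R\<close> is at most \<open>\<tau> (B j)\<close>. Replacing \<open>\<mu>\<close> by \<open>m\<close> costs two factors \<open>q\<close>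
    and makes the sum over the cells bounded independently of \<open>c\<close> and \<open>d\<close>.\<close>
  have trunc_part: "l j * \<sigma> (I j) \<le> min (l j) R * \<sigma> (I j) + 
      \<epsilon> * (F * q\<^sup>2 * Re (trace (m (x (Suc j)) - m (x j))) + \<delta> * p * \<sigma> (I j))" if "j < N" for j
  proof -
    have Bpsd: "pos_semidef (B j)"
      unfolding BD using \<delta> by (intro pos_semidef_add Dpsd pos_semidef_scaleR_mat1) auto
    have "Re (det (B j)) > 0"
      unfolding BD by (rule log_det_tangent(1)[OF Dpsd \<delta>])
    then have "l j \<le> \<tau> (B j) + R"
      using \<tau>_ln[OF Bpsd] by (simp add: ln_ext_def l_def)
    then have "l j \<le> min (l j) R + \<tau> (B j)"
      using \<tau>_pos[OF Bpsd] by linarith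
    also have "\<tau> (B j) = \<epsilon> * (Re (trace (D j)) + \<delta> * p)"
      by (simp add: \<tau>_def BD trace_add Re_trace_scaleR_mat1 p_def)
    finally have "l j * \<sigma> (I j) \<le> (min (l j) R + \<epsilon> * (Re (trace (D j)) + \<delta> * p)) * \<sigma> (I j)"
      by (intro mult_right_mono \<sigma>_nonneg)
    also have "\<dots> = min (l j) R * \<sigma> (I j) + \<epsilon> * (Re (trace (D j)) * \<sigma> (I j) + \<delta> * p * \<sigma> (I j))"
      by (simp add: algebra_simps)
    finally have 1: "l j * \<sigma> (I j) \<le> min (l j) R * \<sigma> (I j) + \<epsilon> * (Re (trace (D j)) * \<sigma> (I j) + \<delta> * p * \<sigma> (I j))" .
    have "\<sigma> (I j) \<le> F * (q * wt (x j)) * h"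
    proof (rule \<sigma>_upper)
      fix t assume "t \<in> I j"
      then have "wt t \<le> q * wt (x j)"
        using osc[of t "x j"] cell[of t j] xj[of j] that by (auto simp: I_def)
      then show "f t * wt t \<le> F * (q * wt (x j))"
        using f_le[of t] f_pos[of t] wt_pos[of t] F_pos by (intro mult_mono) (auto simp: less_imp_le)
    qed
    then have "Re (trace (D j)) * \<sigma> (I j) \<le> Re (trace (D j)) * (F * (q * wt (x j)) * h)"
      by (intro mult_left_mono pos_semidef_trace_nonneg Dpsd)
    also have "\<dots> = F * q\<^sup>2 * (wt (x j) / q * (h * Re (trace (D j))))"
      using q by (simp add: power2_eq_square)
    also have "h * Re (trace (D j)) = Re (trace (\<mu> (x (Suc j)) - \<mu> (x j)))"
      unfolding hD[symmetric] using bounded_linear_scale[OF bounded_linear_Re_trace, of h "D j"] by simp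
    also have "F * q\<^sup>2 * (wt (x j) / q * Re (trace (\<mu> (x (Suc j)) - \<mu> (x j)))) \<le> 
        F * q\<^sup>2 * Re (trace (m (x (Suc j)) - m (x j)))"
    proof (intro mult_left_mono)
      have "wt (x j) / q \<le> wt t \<and> wt t \<le> q * wt (x j)" if "t \<in> {x j..x (Suc j)}" for t
        using osc[of "x j" t] osc[of t "x j"] cell[of t j] xj[of j] that \<open>j < N\<close> q 
        by (auto simp: divide_le_eq mult.commute)
      from \<mu>_m[OF _ bounded_linear_Re_trace pos_semidef_trace_nonneg this]
      show "wt (x j) / q * Re (trace (\<mu> (x (Suc j)) - \<mu> (x j))) \<le> Re (trace (m (x (Suc j)) - m (x j)))"
        using h by (simp add: xS)
    qed (use F_pos in auto)
    finally have "\<epsilon> * (Re (trace (D j)) * \<sigma> (I j)) \<le> \<epsilon> * (F * q\<^sup>2 * Re (trace (m (x (Suc j)) - m (x j))))"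
      using \<epsilon> by (intro mult_left_mono) auto
    with 1 show ?thesis
      unfolding distrib_left by linarith
  qed
  have tele: "(\<Sum>j<N. Re (trace (m (x (Suc j)) - m (x j)))) \<le> M"
  proof -
    have "(\<Sum>j<N. Re (trace (m (x (Suc j)) - m (x j)))) = Re (trace (m d - m c))"
      using sum_lessThan_telescope[of "\<lambda>j. Re (trace (m (x j)))" N] by (simp add: trace_sub x0 xN)
    then show ?thesis
      using trace_increment_le[of c d] cd by simp
  qed
  have "(\<Sum>j<N. q * f (x j) * \<psi> j (m (x (Suc j)) - m (x j)) + (l j - p) * \<sigma> (I j)) \<le> 
     (\<Sum>j<N. min (l j) R * \<sigma> (I j) + \<epsilon> * F * q\<^sup>2 * Re (trace (m (x (Suc j)) - m (x j))) 
        + (p * (q^4 - 1) + \<epsilon> * \<delta> * p) * \<sigma> (I j))"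
  proof (rule sum_mono)
    fix j assume "j \<in> {..<N}"
    then have "j < N" by simp
    from tangent_part[OF this] trunc_part[OF this]
    show "q * f (x j) * \<psi> j (m (x (Suc j)) - m (x j)) + (l j - p) * \<sigma> (I j) \<le> 
      min (l j) R * \<sigma> (I j) + \<epsilon> * F * q\<^sup>2 * Re (trace (m (x (Suc j)) - m (x j))) 
        + (p * (q^4 - 1) + \<epsilon> * \<delta> * p) * \<sigma> (I j)"
      by (simp add: algebra_simps)
  qed
  also have "\<dots> = (\<Sum>j<N. min (l j) R * \<sigma> (I j)) + \<epsilon> * F * q\<^sup>2 * (\<Sum>j<N. Re (trace (m (x (Suc j)) - m (x j)))) 
        + (p * (q^4 - 1) + \<epsilon> * \<delta> * p) * (\<Sum>j<N. \<sigma> (I j))"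
    by (simp add: sum.distrib sum_distrib_left)
  also have "\<dots> \<le> (\<Sum>j<N. min (l j) R * \<sigma> (I j)) + \<epsilon> * F * q\<^sup>2 * M 
        + (p * (q^4 - 1) + \<epsilon> * \<delta> * p) * \<sigma> UNIV"
    using \<epsilon> F_pos \<delta> q by (intro add_mono mult_left_mono order_refl \<sigma>I tele) (auto simp: p_def intro!: add_nonneg_nonneg)
  finally have "a (\<lambda>j. m (x (Suc j)) - m (x j)) \<le> (\<Sum>j<N. min (l j) R * \<sigma> (I j)) + 
      ((p * (q^4 - 1) + \<epsilon> * \<delta> * p) * \<sigma> UNIV + \<epsilon> * F * M * (1 + q\<^sup>2) + R * \<sigma> (S - {c<..d}))"
    by (simp add: a_def algebra_simps)
  with lim show ?thesis
    unfolding l_def I_def by (meson ereal_less_eq(3) order_trans)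
qed

lemma fine_mesh:
  assumes "c < d" "\<eta> > 0"
  obtains N :: nat where "N > 0" "(d - c) / real N \<le> \<eta>"
    "\<And>s t. s \<in> {c..d} \<Longrightarrow> t \<in> {c..d} \<Longrightarrow> \<bar>s - t\<bar> \<le> (d - c) / real N \<Longrightarrow> 
      f s \<le> exp \<eta> * f t \<and> wt s \<le> exp \<eta> * wt t"
proof -
  obtain e1 where "e1 > 0" and e1: "\<And>s t. s \<in> {c..d} \<Longrightarrow> t \<in> {c..d} \<Longrightarrow> \<bar>s - t\<bar> < e1 \<Longrightarrow> f s \<le> exp \<eta> * f t"
    using positive_continuous_ratio[OF continuous_on_subset[OF f_cont] f_pos \<open>\<eta> > 0\<close>] by blast
  obtain e2 where "e2 > 0" and e2: "\<And>s t. s \<in> {c..d} \<Longrightarrow> t \<in> {c..d} \<Longrightarrow> \<bar>s - t\<bar> < e2 \<Longrightarrow> wt s \<le> exp \<eta> * wt t"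
    using positive_continuous_ratio[OF continuous_on_wt wt_pos \<open>\<eta> > 0\<close>] by blast
  define e where "e = min \<eta> (min e1 e2)"
  have "e > 0"
    using \<open>e1 > 0\<close> \<open>e2 > 0\<close> \<open>\<eta> > 0\<close> by (simp add: e_def)
  obtain N :: nat where N: "(d - c) / e < real N"
    using reals_Archimedean2 by blast
  have "0 < (d - c) / e"
    using \<open>c < d\<close> \<open>e > 0\<close> by simp
  with N have "N > 0"
    by (cases N) auto
  with N have small: "(d - c) / real N < e"
    using \<open>e > 0\<close> by (simp add: divide_less_eq mult.commute)
  show thesis
  proof (rule that[OF \<open>N > 0\<close>])
    show "(d - c) / real N \<le> \<eta>"
      using small by (simp add: e_def)
    fix s t assume "s \<in> {c..d}" "t \<in> {c..d}" "\<bar>s - t\<bar> \<le> (d - c) / real N"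
    then show "f s \<le> exp \<eta> * f t \<and> wt s \<le> exp \<eta> * wt t"
      using small e1[of s t] e2[of s t] by (simp add: e_def)
  qed
qed

lemma tail_tendsto_0:
  assumes S: "S \<in> sets lebesgue" and ev: "\<And>t. t \<in> S \<Longrightarrow> \<forall>\<^sub>F n in sequentially. t \<in> {c n<..d n}"
  shows "(\<lambda>n. \<sigma> (S - {c n<..d n})) \<longlonglongrightarrow> 0"
proof -
  let ?g = "\<lambda>n t. indicator (S - {c n<..d n}) t *\<^sub>R (f t * wt t)"
  have int: "integrable lebesgue (\<lambda>t. f t * wt t)"
    using fw_integrable[of UNIV] by (simp add: set_integrable_def)
  have "(\<lambda>n. LINT t|lebesgue. ?g n t) \<longlonglongrightarrow> (LINT t|(lebesgue :: real measure). (0 :: real))"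
  proof (rule integral_dominated_convergence[where w = "\<lambda>t. f t * wt t"])
    have "S - {c n<..d n} \<in> sets lebesgue" for n
      using S by (intro sets.Diff) auto
    then have "integrable lebesgue (?g n)" for n
      by (intro integrable_mult_indicator int)
    then show "?g n \<in> borel_measurable lebesgue" for n
      by (rule borel_measurable_integrable)
    show "AE t in lebesgue. (\<lambda>n. ?g n t) \<longlonglongrightarrow> 0"
    proof (intro AE_I2 tendsto_eventually)
      fix t
      show "\<forall>\<^sub>F n in sequentially. ?g n t = 0"
      proof (cases "t \<in> S")
        case True
        from ev[OF this] show ?thesis
          by eventually_elim (simp add: indicator_def)
      qed (simp add: indicator_def)
    qed
    show "AE t in lebesgue. norm (?g n t) \<le> f t * wt t" for n
      using f_pos wt_pos by (intro AE_I2) (auto simp: indicator_def abs_mult less_imp_le)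
  qed (use int in auto)
  then show ?thesis
    by (simp add: \<sigma>_def set_lebesgue_integral_def)
qed

text \<open>The restriction on \<open>\<epsilon>\<close> makes the truncation level \<open>R\<close> nonnegative; otherwise the zero values of the
  step functions outside \<open>(l n, u n]\<close> would exceed \<open>R\<close>.\<close>

lemma limsup_log_det_le_add:
  assumes ab: "a < b" and deriv: "AE t in lebesgue. (\<mu> has_vector_derivative \<mu>' t) (at t)"
    and \<epsilon>: "0 < \<epsilon>" "\<epsilon> \<le> exp (- 1)"
  shows "limsup (log_int (einterval a b)) \<le> 
    integral_ext (einterval a b) (\<lambda>t. ereal (f t * wt t) * ln_ext (Re (det (\<mu>' t)))) + ereal (2 * \<epsilon> * F * M)"
proof -
  define S where "S = einterval a b"
  have S: "S \<in> sets lebesgue"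
    by (simp add: S_def)
  define p where "p = real CARD('p)"
  define R where "R = - p * (1 + ln \<epsilon>)"
  have "R \<ge> 0"
  proof -
    have "ln \<epsilon> \<le> - 1"
      using \<epsilon> by (metis exp_gt_zero ln_exp ln_le_cancel_iff)
    then show ?thesis
      by (simp add: R_def p_def mult_nonneg_nonpos)
  qed
  obtain u l :: "nat \<Rightarrow> real" where "einterval a b = (\<Union>i. {l i..u i})" "incseq u" "decseq l"
    and ul: "\<And>n. l n < u n" "\<And>n. a < l n" "\<And>n. u n < b"
    and l_lim: "(\<lambda>n. ereal (l n)) \<longlonglongrightarrow> a" and u_lim: "(\<lambda>n. ereal (u n)) \<longlonglongrightarrow> b"
    by (rule einterval_Icc_approximation[OF ab], rule that)
  have sub: "{l n<..u n} \<subseteq> S" for n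
  proof
    fix t assume "t \<in> {l n<..u n}"
    then have "ereal (l n) < ereal t" "ereal t \<le> ereal (u n)"
      by simp_all
    then show "t \<in> S"
      using less_trans[OF ul(2)[of n]] le_less_trans[OF _ ul(3)[of n]] by (simp add: S_def einterval_def)
  qed
  have ev: "\<forall>\<^sub>F n in sequentially. t \<in> {l n<..u n}" if "t \<in> S" for t
  proof -
    have "a < ereal t" "ereal t < b"
      using that by (auto simp: S_def einterval_def)
    from order_tendstoD(2)[OF l_lim this(1)] order_tendstoD(1)[OF u_lim this(2)]
    show ?thesis
      by eventually_elim auto
  qed
  define \<delta> where "\<delta> n = 1 / real (Suc n)" for n
  have \<delta>: "\<delta> n > 0" for n
    by (simp add: \<delta>_def)
  have \<delta>_lim: "\<delta> \<longlonglongrightarrow> 0"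
    unfolding \<delta>_def using LIMSEQ_inverse_real_of_nat by (simp add: inverse_eq_divide)
  have "\<exists>N>0. (u n - l n) / real N \<le> \<delta> n \<and> (\<forall>s t. s \<in> {l n..u n} \<longrightarrow> t \<in> {l n..u n} \<longrightarrow> 
      \<bar>s - t\<bar> \<le> (u n - l n) / real N \<longrightarrow> f s \<le> exp (\<delta> n) * f t \<and> wt s \<le> exp (\<delta> n) * wt t)" for n
    by (rule fine_mesh[OF ul(1)[of n] \<delta>[of n]]) blast
  then obtain N where N: "\<And>n. N n > 0" "\<And>n. (u n - l n) / real (N n) \<le> \<delta> n"
    and osc: "\<And>n s t. s \<in> {l n..u n} \<Longrightarrow> t \<in> {l n..u n} \<Longrightarrow> 
      \<bar>s - t\<bar> \<le> (u n - l n) / real (N n) \<Longrightarrow> f s \<le> exp (\<delta> n) * f t \<and> wt s \<le> exp (\<delta> n) * wt t"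
    by metis
  define h where "h n = (u n - l n) / real (N n)" for n
  define x where "x n j = l n + real j * h n" for n j
  have h: "h n > 0" for n
    using ul(1)[of n] N(1)[of n] by (simp add: h_def)
  have xS: "x n (Suc j) - x n j = h n" for n j
    by (simp add: x_def distrib_right)
  have mono: "mono (x n)" for n
    using h[of n] by (auto simp: mono_def x_def intro!: mult_right_mono)
  have cells: "(\<Union>j<N n. {x n j<..x n (Suc j)}) = {l n<..u n}" for n
    unfolding UN_uniform_cells[OF mono] using N(1)[of n] by (simp add: x_def h_def)
  define val where "val n j = min (ln (Re (det ((\<mu> (x n (Suc j)) - \<mu> (x n j)) /\<^sub>R h n + \<delta> n *\<^sub>R mat 1)))) R" for n j
  define H where "H n t = (\<Sum>j<N n. val n j * (indicator {x n j<..x n (Suc j)} t * (f t * wt t)))" for n t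
  define E where "E n = (p * (exp (\<delta> n) ^ 4 - 1) + \<epsilon> * \<delta> n * p) * \<sigma> UNIV + \<epsilon> * F * M * (1 + (exp (\<delta> n))\<^sup>2) 
      + R * \<sigma> (S - {l n<..u n})" for n
  have cell_sub: "{x n j<..x n (Suc j)} \<subseteq> S" if "j < N n" for n j
    using cells[of n] sub[of n] that by blast
  have H_cell: "H n t = f t * wt t * val n j" if "j < N n" "t \<in> {x n j<..x n (Suc j)}" for n t j
  proof -
    have "t \<notin> {x n i<..x n (Suc i)}" if "i \<noteq> j" for i
      using disjoint_cells[OF mono[of n], of UNIV] that \<open>t \<in> {x n j<..x n (Suc j)}\<close> 
      unfolding disjoint_family_on_def by blast
    then have "H n t = (\<Sum>i<N n. if i = j then f t * wt t * val n j else 0)"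
      unfolding H_def using that(2) by (intro sum.cong) (auto simp: indicator_def)
    then show ?thesis
      using that(1) by simp
  qed
  have H_out: "H n t = 0" if "t \<notin> {l n<..u n}" for n t
  proof -
    have "t \<notin> {x n j<..x n (Suc j)}" if "j < N n" for j
      using cells[of n] that \<open>t \<notin> {l n<..u n}\<close> by blast
    then show ?thesis
      unfolding H_def by (intro sum.neutral) (simp add: indicator_def)
  qed
  have cell_int: "integrable lebesgue (\<lambda>t. indicator {x n j<..x n (Suc j)} t * (f t * wt t))" for n j
    using fw_integrable[of "{x n j<..x n (Suc j)}"] by (simp add: set_integrable_def)
  have H_int: "integrable lebesgue (H n)" for n
    unfolding H_def by (intro Bochner_Integration.integrable_sum integrable_mult_right cell_int)
  have H_integral: "(LINT t:S|lebesgue. H n t) = (\<Sum>j<N n. val n j * \<sigma> {x n j<..x n (Suc j)})" for n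
  proof -
    have "indicator S t *\<^sub>R H n t = H n t" for t
    proof (cases "t \<in> S")
      case False
      then have "t \<notin> {l n<..u n}"
        using subsetD[OF sub] by metis
      then show ?thesis
        by (simp add: H_out)
    qed simp
    then have "(LINT t:S|lebesgue. H n t) = (LINT t|lebesgue. H n t)"
      by (simp only: set_lebesgue_integral_def)
    also have "\<dots> = (\<Sum>j<N n. val n j * \<sigma> {x n j<..x n (Suc j)})"
      unfolding H_def \<sigma>_def set_lebesgue_integral_def using cell_int
      by (subst Bochner_Integration.integral_sum) auto
    finally show ?thesis .
  qed
  have "limsup (log_int S) \<le> ereal (LINT t:S|lebesgue. H n t) + ereal (E n)" for n
  proof -
    have "limsup (log_int S) \<le> ereal ((\<Sum>j<N n. val n j * \<sigma> {x n j<..x n (Suc j)}) + E n)"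
      unfolding val_def E_def x_def h_def R_def p_def
      using \<epsilon> \<delta>[of n] by (intro step_estimate ul N S sub osc) auto
    then show ?thesis
      by (simp add: H_integral)
  qed
  then have "limsup (log_int S) \<le> limsup (\<lambda>n. ereal (LINT t:S|lebesgue. H n t) + ereal (E n))"
    by (intro le_Limsup) auto
  also have "\<dots> \<le> limsup (\<lambda>n. ereal (LINT t:S|lebesgue. H n t)) + limsup (\<lambda>n. ereal (E n))"
    by (rule ereal_limsup_add_mono)
  also have "limsup (\<lambda>n. ereal (E n)) = ereal (2 * \<epsilon> * F * M)"
  proof (rule lim_imp_Limsup)
    have "E \<longlonglongrightarrow> (p * (exp 0 ^ 4 - 1) + \<epsilon> * 0 * p) * \<sigma> UNIV + \<epsilon> * F * M * (1 + (exp 0)\<^sup>2) + R * 0"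
      unfolding E_def by (intro tendsto_intros \<delta>_lim tail_tendsto_0 S ev)
    then show "(\<lambda>n. ereal (E n)) \<longlonglongrightarrow> ereal (2 * \<epsilon> * F * M)"
      by (simp add: mult_ac)
  qed simp
  also have "limsup (\<lambda>n. ereal (LINT t:S|lebesgue. H n t)) \<le> 
      integral_ext S (\<lambda>t. ereal (f t * wt t) * min (ln_ext (Re (det (\<mu>' t)))) (ereal R))"
  proof (rule limsup_set_integral_le_integral_ext)
    show "set_integrable lebesgue S (\<lambda>t. R * (f t * wt t))"
      using fw_integrable[OF S] by simp
    show "set_integrable lebesgue S (H n)" for n
      by (intro set_integrableI H_int S)
    show "H n t \<le> R * (f t * wt t)" for n t
    proof (cases "t \<in> {l n<..u n}")
      case True
      then obtain j where "j < N n" "t \<in> {x n j<..x n (Suc j)}"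
        unfolding cells[symmetric] by blast
      then show ?thesis
        using f_pos[of t] wt_pos[of t] by (simp add: H_cell val_def mult.commute mult_right_mono)
    next
      case False
      then show ?thesis
        using f_pos[of t] wt_pos[of t] \<open>R \<ge> 0\<close> by (simp add: H_out)
    qed
    show "AE t in lebesgue. t \<in> S \<longrightarrow> 
        (\<lambda>n. ereal (H n t)) \<longlonglongrightarrow> ereal (f t * wt t) * min (ln_ext (Re (det (\<mu>' t)))) (ereal R)"
      using deriv
    proof (eventually_elim, intro impI)
      fix t assume t: "(\<mu> has_vector_derivative \<mu>' t) (at t)" "t \<in> S"
      define B where "B n \<alpha> \<beta> = (\<mu> \<beta> - \<mu> \<alpha>) /\<^sub>R (\<beta> - \<alpha>) + \<delta> n *\<^sub>R mat 1" for n \<alpha> \<beta>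
      \<comment> \<open>The cell that contains \<open>t\<close>; for the finitely many \<open>n\<close> with \<open>t\<close> outside \<open>(l n, u n]\<close> an
        arbitrary short interval at \<open>t\<close> serves.\<close>
      have "\<exists>\<alpha> \<beta>. \<alpha> \<le> t \<and> t \<le> \<beta> \<and> \<alpha> < \<beta> \<and> \<beta> - \<alpha> \<le> \<delta> n \<and> 
          (t \<in> {l n<..u n} \<longrightarrow> H n t = f t * wt t * min (ln (Re (det (B n \<alpha> \<beta>)))) R)" for n
      proof (cases "t \<in> {l n<..u n}")
        case True
        then obtain j where "j < N n" "t \<in> {x n j<..x n (Suc j)}"
          unfolding cells[symmetric] by blast
        then show ?thesis
          using N(2)[of n] h[of n] xS[of n j]
          by (intro exI[of _ "x n j"] exI[of _ "x n (Suc j)"]) (auto simp: H_cell val_def B_def h_def)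
      next
        case False
        then show ?thesis
          using \<delta>[of n] by (intro exI[of _ "t - \<delta> n"] exI[of _ t]) auto
      qed
      then obtain \<alpha> \<beta> where \<alpha>\<beta>: "\<And>n. \<alpha> n \<le> t" "\<And>n. t \<le> \<beta> n" "\<And>n. \<alpha> n < \<beta> n" "\<And>n. \<beta> n - \<alpha> n \<le> \<delta> n"
        and H\<alpha>\<beta>: "\<And>n. t \<in> {l n<..u n} \<Longrightarrow> H n t = f t * wt t * min (ln (Re (det (B n (\<alpha> n) (\<beta> n))))) R"
        by metis
      have "(\<lambda>n. \<beta> n - \<alpha> n) \<longlonglongrightarrow> 0"
        using \<alpha>\<beta> by (intro tendsto_sandwich[OF _ _ tendsto_const \<delta>_lim]) (auto simp: less_imp_le)
      from has_vector_derivative_straddle[OF t(1) \<alpha>\<beta>(1-3) this]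
      have "(\<lambda>n. B n (\<alpha> n) (\<beta> n)) \<longlonglongrightarrow> \<mu>' t + 0 *\<^sub>R mat 1"
        unfolding B_def by (intro tendsto_intros \<delta>_lim)
      then have "(\<lambda>n. Re (det (B n (\<alpha> n) (\<beta> n)))) \<longlonglongrightarrow> Re (det (\<mu>' t))"
        by (intro tendsto_Re_det) simp
      moreover have "Re (det (B n (\<alpha> n) (\<beta> n))) > 0" for n
        unfolding B_def using \<alpha>\<beta>(3)[of n]
        by (intro log_det_tangent(1) pos_semidef_scaleR \<mu>_psd \<delta>) auto
      ultimately have "(\<lambda>n. ereal (ln (Re (det (B n (\<alpha> n) (\<beta> n)))))) \<longlonglongrightarrow> ln_ext (Re (det (\<mu>' t)))"
        by (intro tendsto_ln_ext)
      then have "(\<lambda>n. ereal (f t * wt t) * min (ereal (ln (Re (det (B n (\<alpha> n) (\<beta> n)))))) (ereal R)) \<longlonglongrightarrow> 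
          ereal (f t * wt t) * min (ln_ext (Re (det (\<mu>' t)))) (ereal R)"
        by (intro tendsto_cmult_ereal tendsto_min tendsto_const) auto
      moreover have "\<forall>\<^sub>F n in sequentially. 
          ereal (f t * wt t) * min (ereal (ln (Re (det (B n (\<alpha> n) (\<beta> n)))))) (ereal R) = ereal (H n t)"
        using ev[OF t(2)]
      proof eventually_elim
        case (elim n)
        have "ereal r * min (ereal y) (ereal R) = ereal (r * min y R)" for r y
          by (simp add: min_def)
        then show ?case
          by (simp only: H\<alpha>\<beta>[OF elim])
      qed
      ultimately show "(\<lambda>n. ereal (H n t)) \<longlonglongrightarrow> ereal (f t * wt t) * min (ln_ext (Re (det (\<mu>' t)))) (ereal R)"
        by (rule Lim_transform_eventually)
    qed
  qed
  also have "integral_ext S (\<lambda>t. ereal (f t * wt t) * min (ln_ext (Re (det (\<mu>' t)))) (ereal R)) \<le>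
      integral_ext S (\<lambda>t. ereal (f t * wt t) * ln_ext (Re (det (\<mu>' t))))"
    using f_pos wt_pos by (intro integral_ext_mono ereal_mult_left_mono) (auto simp: less_imp_le)
  finally show ?thesis
    unfolding S_def by (simp add: add_right_mono)
qed

lemma limsup_log_det_le:
  assumes ab: "a < b" and deriv: "AE t in lebesgue. (\<mu> has_vector_derivative \<mu>' t) (at t)"
  shows "limsup (log_int (einterval a b)) \<le> 
    integral_ext (einterval a b) (\<lambda>t. ereal (f t * wt t) * ln_ext (Re (det (\<mu>' t))))"
    (is "?l \<le> ?r")
proof (rule ereal_le_epsilon2)
  fix e :: real assume "e > 0"
  define C where "C = 2 * F * (\<bar>M\<bar> + 1)"
  have "C > 0"
    using F_pos by (simp add: C_def)
  define \<epsilon> where "\<epsilon> = min (exp (- 1)) (e / C)"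
  have \<epsilon>: "0 < \<epsilon>" "\<epsilon> \<le> exp (- 1)"
    using \<open>e > 0\<close> \<open>C > 0\<close> by (auto simp: \<epsilon>_def)
  have "2 * \<epsilon> * F * M \<le> \<epsilon> * C"
    using F_pos \<epsilon> by (auto simp: C_def mult_ac intro!: mult_left_mono)
  also have "\<dots> \<le> e"
    using \<open>C > 0\<close> by (simp add: \<epsilon>_def min_def divide_le_eq pos_le_divide_eq not_le)
  finally have "?r + ereal (2 * \<epsilon> * F * M) \<le> ?r + ereal e"
    by (intro add_left_mono) simp
  with limsup_log_det_le_add[OF ab deriv \<epsilon>] show "?l \<le> ?r + ereal e"
    by (rule order_trans)
qed

end

section \<open>Semicontinuity of the logarithmic integral\<close>

theorem propositionB1:
  fixes \<mu> \<mu>' :: "real \<Rightarrow> complex^'p^'p"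
    and P :: "nat \<Rightarrow> real \<Rightarrow> complex^'p^'p"
    and \<gamma> :: "complex^'p^'p"
    and M :: real
    and f :: "real \<Rightarrow> real"
    and a b :: ereal
  assumes \<mu>_mono: "herm_nondecreasing \<mu>"
    and \<mu>_fin: "RS_integrable_UNIV (\<lambda>t. 1 / (1 + t\<^sup>2)) \<mu>"
    and \<mu>'_def: "ac_derivative \<mu> \<mu>'"
    and P_psd: "\<And>k t. pos_semidef (P k t)"
    and P_int: "\<And>k. integrable lebesgue (\<lambda>t. (1 / (1 + t\<^sup>2)) *\<^sub>R P k t)"
    and M_pos: "M > 0"
    and P_bound: "\<And>k. (LINT t|lebesgue. (1 / (1 + t\<^sup>2)) *\<^sub>R P k t) \<le>\<^sub>H M *\<^sub>R mat 1"
    and \<gamma>_psd: "pos_semidef \<gamma>"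
    and P_lim: "\<And>x. (\<lambda>k. LINT t:{..x}|lebesgue. (1 / (1 + t\<^sup>2)) *\<^sub>R P k t)
        \<longlonglongrightarrow> \<gamma> + RS_integral_atMost (\<lambda>t. 1 / (1 + t\<^sup>2)) \<mu> x"
    and f_cont: "continuous_on UNIV f"
    and f_bdd: "bounded (range f)"
    and f_pos: "\<And>t. f t > 0"
    and ab: "a < b"
  shows "limsup (\<lambda>k. log_det_integral a b f (P k)) \<le> log_det_integral a b f \<mu>'"
proof -
  obtain F where F: "\<And>t. f t \<le> F"
    using f_bdd unfolding bounded_iff by (metis abs_le_D1 rangeI real_norm_def)
  have \<mu>_psd: "pos_semidef (\<mu> t - \<mu> s)" if "s \<le> t" for s t
    using monotoneD[OF \<mu>_mono that] by (simp add: herm_le_def)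
  have "weak_limit \<mu> (RS_integral_atMost wt \<mu>) P (M * real CARD('p)) F f"
  proof
    show W_int: "integrable lebesgue (\<lambda>t. wt t *\<^sub>R P k t)" for k
      unfolding wt_def by (rule P_int)
    show "Re (trace (LINT t|lebesgue. wt t *\<^sub>R P k t)) \<le> M * real CARD('p)" for k
    proof -
      have "0 \<le> Re (trace (M *\<^sub>R mat 1 - (LINT t|lebesgue. wt t *\<^sub>R P k t)))"
        using P_bound[of k] unfolding herm_le_def wt_def by (intro pos_semidef_trace_nonneg) auto
      then show ?thesis
        by (simp add: trace_sub Re_trace_scaleR_mat1)
    qed
    show "(\<lambda>k. LINT t:{c<..d}|lebesgue. wt t *\<^sub>R P k t) \<longlonglongrightarrow> 
        RS_integral_atMost wt \<mu> d - RS_integral_atMost wt \<mu> c" if "c \<le> d" for c d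
    proof -
      have int: "set_integrable lebesgue A (\<lambda>t. wt t *\<^sub>R P k t)" if "A \<in> sets lebesgue" for A k
        unfolding set_integrable_def using that W_int by (intro integrable_mult_indicator)
      have "{..d} = {..c} \<union> {c<..d}"
        using that by auto
      then have "(LINT t:{..d}|lebesgue. wt t *\<^sub>R P k t) = 
          (LINT t:{..c}|lebesgue. wt t *\<^sub>R P k t) + (LINT t:{c<..d}|lebesgue. wt t *\<^sub>R P k t)" for k
        by (simp only:) (intro set_integral_Un int, auto)
      then have eq: "(LINT t:{c<..d}|lebesgue. wt t *\<^sub>R P k t) = 
          (LINT t:{..d}|lebesgue. wt t *\<^sub>R P k t) - (LINT t:{..c}|lebesgue. wt t *\<^sub>R P k t)" for k
        by simp
      show ?thesis
        unfolding eq using tendsto_diff[OF P_lim[of d] P_lim[of c]] unfolding wt_def[abs_def] by simp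
    qed
    show "\<alpha> * \<psi> (\<mu> d - \<mu> c) \<le> \<psi> (RS_integral_atMost wt \<mu> d - RS_integral_atMost wt \<mu> c) \<and> 
        \<psi> (RS_integral_atMost wt \<mu> d - RS_integral_atMost wt \<mu> c) \<le> \<beta> * \<psi> (\<mu> d - \<mu> c)"
      if cd: "c \<le> d" and \<psi>: "bounded_linear \<psi>" and pos: "\<And>A. pos_semidef A \<Longrightarrow> 0 \<le> (\<psi> A :: real)"
        and w: "\<And>t. t \<in> {c..d} \<Longrightarrow> \<alpha> \<le> wt t \<and> wt t \<le> \<beta>" for c d \<alpha> \<beta> \<psi>
    proof -
      have I: "has_RS_integral wt \<mu> c d (RS_integral_atMost wt \<mu> d - RS_integral_atMost wt \<mu> c)"
        using has_RS_integral_increment[OF \<mu>_fin cd] unfolding wt_def[abs_def] .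
      have "mono (\<lambda>t. \<psi> (\<mu> t))"
        using pos[OF \<mu>_psd] by (intro monoI) (simp add: linear_diff[OF bounded_linear.linear[OF \<psi>]])
      from has_RS_integral_bounds[OF I cd \<psi> this] w show ?thesis
        by blast
    qed
  qed (use F f_cont f_pos P_psd \<mu>_psd in auto)
  from weak_limit.limsup_log_det_le[OF this ab ac_derivative_imp_derivative[OF \<mu>'_def]]
  show ?thesis
    unfolding log_det_integral_def wt_def by simp
qed

end
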